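(* Let $n\ge 1$ and let $\Gamma$ be a finite simple graph with vertex set $V(\Gamma)=\{v_i\}_{1\le i\le m}$. Suppose that there are nonempty subsets $D_1,\ldots,D_m$ of $\{1,\ldots,n\}$ such that, for all $i\neq j$, $D_i\cap D_j=\emptyset$ if and only if $v_i$ and $v_j$ are connected by an edge of $\Gamma$. Then the right-angled Artin group $A_\Gamma$ embeds into the $n$-dimensional Thompson group $nV$, i.e. there is an injective group homomorphism $A_\Gamma\to nV$.
   Context: For a finite simple graph $\Gamma$ with vertices $v_1,\ldots,v_m$ and edge set $E(\Gamma)$, the right-angled Artin group is $A_\Gamma=\langle g_1,\ldots,g_m\mid g_ig_j=g_jg_i \text{ for all }\{v_i,v_j\}\in E(\Gamma)\rangle$. Let $I=[0,1)$. An $n$-dimensional rectangle is a subset of $I^n$ obtained by repeated dyadic divisions, i.e. a product $\prod_{d=1}^n I_d$ where each $I_d$ is of the form $[a/2^k,(a+1)/2^k)$ with integers $k\ge 0$, $0\le a<2^k$ (depending on $d$). An $n$-dimensional pattern is a finite set of pairwise disjoint $n$-dimensional rectangles whose union is $I^n$. A numbered pattern is a pattern together with a bijection to $\{0,\ldots,r-1\}$, where $r$ is the number of its rectangles. For numbered patterns $P=\{P_i\}_{0\le i\le r-1}$ and $Q=\{Q_i\}_{0\le i\le r-1}$ with the same number of rectangles, $v(P,Q):I^n\to I^n$ is the bijection taking each $P_i$ onto $Q_i$ affinely and preserving orientation (in each coordinate, an increasing affine map). The $n$-dimensional Thompson group $nV$ is the group, under composition, of all maps $v(P,Q)$. *)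

theory Defs
  imports Complex_Main "HOL-Algebra.Bij" "HOL-Library.Disjoint_Sets"
begin

section \<open>Groups given by generators and relations\<close>

text \<open>A word is a list of letters: \<open>(x, True)\<close> stands for the generator \<open>x\<close> and
  \<open>(x, False)\<close> for its inverse. A relation \<open>u = w\<close> is encoded as the pair \<open>(u, w)\<close>.\<close>

type_synonym 'a word = "('a \<times> bool) list"

definition words :: "'a set \<Rightarrow> 'a word set"
  where "words S = lists (S \<times> UNIV)"

inductive word_eq :: "'a set \<Rightarrow> ('a word \<times> 'a word) set \<Rightarrow> 'a word \<Rightarrow> 'a word \<Rightarrow> bool"
  for S R
where
  refl: "w \<in> words S \<Longrightarrow> word_eq S R w w"
| sym: "word_eq S R u w \<Longrightarrow> word_eq S R w u"
| trans: "word_eq S R t u \<Longrightarrow> word_eq S R u w \<Longrightarrow> word_eq S R t w"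
| append: "word_eq S R u u' \<Longrightarrow> word_eq S R w w' \<Longrightarrow> word_eq S R (u @ w) (u' @ w')"
| cancel: "x \<in> S \<Longrightarrow> word_eq S R [(x, b), (x, \<not> b)] []"
| relation: "(u, w) \<in> R \<Longrightarrow> u \<in> words S \<Longrightarrow> w \<in> words S \<Longrightarrow> word_eq S R u w"

definition word_rel :: "'a set \<Rightarrow> ('a word \<times> 'a word) set \<Rightarrow> ('a word \<times> 'a word) set"
  where "word_rel S R = {(u, w). word_eq S R u w}"

definition presented_group ::
    "'a set \<Rightarrow> ('a word \<times> 'a word) set \<Rightarrow> 'a word set monoid"
  where "presented_group S R =
    \<lparr>carrier = words S // word_rel S R,
     mult = \<lambda>A B. \<Union>u\<in>A. \<Union>w\<in>B. word_rel S R `` {u @ w},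
     one = word_rel S R `` {[]}\<rparr>"

lemma word_eq_words: "word_eq S R u w \<Longrightarrow> u \<in> words S \<and> w \<in> words S"
  by (induction rule: word_eq.induct) (auto simp: words_def)

lemma equiv_word_rel: "equiv (words S) (word_rel S R)"
  by (rule equivI)
     (auto simp: word_rel_def refl_on_def sym_def trans_def
           dest: word_eq_words intro: word_eq.intros)

lemma presented_group_mult:
  assumes "u \<in> words S" "w \<in> words S"
  shows "word_rel S R `` {u} \<otimes>\<^bsub>presented_group S R\<^esub> word_rel S R `` {w}
    = word_rel S R `` {u @ w}"
proof -
  have "congruent2 (word_rel S R) (word_rel S R) (\<lambda>u w. word_rel S R `` {u @ w})"
    by (rule congruent2I', rule equiv_class_eq[OF equiv_word_rel])
       (simp add: word_rel_def word_eq.append)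
  from UN_equiv_class2[OF equiv_word_rel equiv_word_rel this assms]
  show ?thesis by (simp add: presented_group_def)
qed

lemma word_eq_inverse:
  assumes "w \<in> words S"
  shows "word_eq S R (rev (map (\<lambda>(x, b). (x, \<not> b)) w) @ w) []"
  using assms
proof (induction w)
  case Nil
  then show ?case by (auto simp: words_def intro: word_eq.refl)
next
  case (Cons l w)
  obtain x b where l: "l = (x, b)" by (cases l)
  let ?v = "rev (map (\<lambda>(x, b). (x, \<not> b)) w)"
  have x: "x \<in> S" and w: "w \<in> words S" using Cons.prems l by (auto simp: words_def)
  then have v: "?v \<in> words S" by (auto simp: words_def)
  have c: "word_eq S R [(x, \<not> b), (x, b)] []"
    using word_eq.cancel[of x S R "\<not> b"] x by simp
  have "word_eq S R (?v @ ([(x, \<not> b), (x, b)] @ w)) (?v @ ([] @ w))"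
    by (intro word_eq.append word_eq.refl c v w)
  then show ?case using Cons.IH[OF w] l by (auto intro: word_eq.trans)
qed

lemma group_presented_group: "group (presented_group S R)"
proof (rule groupI)
  let ?G = "presented_group S R" and ?c = "\<lambda>w. word_rel S R `` {w}"
  have car: "carrier ?G = ?c ` words S"
    by (auto simp: presented_group_def quotient_def)
  have one: "\<one>\<^bsub>?G\<^esub> = ?c []" by (simp add: presented_group_def)
  have nil: "[] \<in> words S" by (simp add: words_def)
  have app: "u @ w \<in> words S" if "u \<in> words S" "w \<in> words S" for u w
    using that by (simp add: words_def)
  show "x \<otimes>\<^bsub>?G\<^esub> y \<in> carrier ?G" if "x \<in> carrier ?G" "y \<in> carrier ?G" for x y
    using that unfolding car by (auto simp: presented_group_mult app)
  show "\<one>\<^bsub>?G\<^esub> \<in> carrier ?G" unfolding car one using nil by blast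
  show "x \<otimes>\<^bsub>?G\<^esub> y \<otimes>\<^bsub>?G\<^esub> z = x \<otimes>\<^bsub>?G\<^esub> (y \<otimes>\<^bsub>?G\<^esub> z)"
    if "x \<in> carrier ?G" "y \<in> carrier ?G" "z \<in> carrier ?G" for x y z
    using that unfolding car by (auto simp: presented_group_mult app)
  show "\<one>\<^bsub>?G\<^esub> \<otimes>\<^bsub>?G\<^esub> x = x" if "x \<in> carrier ?G" for x
    using that nil unfolding car one by (auto simp: presented_group_mult)
  show "\<exists>y\<in>carrier ?G. y \<otimes>\<^bsub>?G\<^esub> x = \<one>\<^bsub>?G\<^esub>" if x: "x \<in> carrier ?G" for x
  proof -
    obtain w where w: "w \<in> words S" and xw: "x = ?c w" using x car by auto
    let ?v = "rev (map (\<lambda>(x, b). (x, \<not> b)) w)"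
    have v: "?v \<in> words S" using w by (auto simp: words_def)
    have "?c ?v \<otimes>\<^bsub>?G\<^esub> x = \<one>\<^bsub>?G\<^esub>"
      unfolding xw one presented_group_mult[OF v w]
      by (rule equiv_class_eq[OF equiv_word_rel]) (simp add: word_rel_def word_eq_inverse[OF w])
    then show ?thesis using v car by blast
  qed
qed


section \<open>Right-angled Artin groups\<close>

definition finite_simple_graph :: "'v set \<Rightarrow> 'v set set \<Rightarrow> bool"
  where "finite_simple_graph V E \<longleftrightarrow>
    finite V \<and> (\<forall>e\<in>E. \<exists>u\<in>V. \<exists>w\<in>V. u \<noteq> w \<and> e = {u, w})"

definition raag :: "'v set \<Rightarrow> 'v set set \<Rightarrow> 'v word set monoid"
  where "raag V E = presented_group V
    {([(u, True), (w, True)], [(w, True), (u, True)]) | u w. {u, w} \<in> E}"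


section \<open>The higher-dimensional Thompson groups\<close>

text \<open>Points of the \<open>n\<close>-dimensional unit cube are functions on the coordinates
  \<open>{1..n}\<close>, extended by \<open>undefined\<close>.\<close>

definition cube :: "nat \<Rightarrow> (nat \<Rightarrow> real) set"
  where "cube n = ({1..n} \<rightarrow>\<^sub>E {0..<1})"

definition dyadic_interval :: "real set \<Rightarrow> bool"
  where "dyadic_interval J \<longleftrightarrow>
    (\<exists>k a :: nat. a < 2 ^ k \<and> J = {real a / 2 ^ k ..< (real a + 1) / 2 ^ k})"

definition rectangle :: "nat \<Rightarrow> (nat \<Rightarrow> real) set \<Rightarrow> bool"
  where "rectangle n A \<longleftrightarrow>
    (\<exists>J. (\<forall>d\<in>{1..n}. dyadic_interval (J d)) \<and> A = Pi\<^sub>E {1..n} J)"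

definition pattern :: "nat \<Rightarrow> (nat \<Rightarrow> real) set set \<Rightarrow> bool"
  where "pattern n X \<longleftrightarrow>
    finite X \<and> (\<forall>A\<in>X. rectangle n A) \<and> disjoint X \<and> \<Union>X = cube n"

text \<open>In \<open>numbered_pattern n r P\<close>, only the values of \<open>P\<close> below \<open>r\<close> matter.\<close>

definition numbered_pattern :: "nat \<Rightarrow> nat \<Rightarrow> (nat \<Rightarrow> (nat \<Rightarrow> real) set) \<Rightarrow> bool"
  where "numbered_pattern n r P \<longleftrightarrow> (\<exists>X. pattern n X \<and> bij_betw P {..<r} X)"

text \<open>\<open>is_v n r P Q f\<close> says that \<open>f\<close> is the map \<open>v(P, Q)\<close>. Both the cube and its bijections
  consist of extensional functions, so \<open>f\<close> is determined by these conditions.\<close>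

definition is_v ::
    "nat \<Rightarrow> nat \<Rightarrow> (nat \<Rightarrow> (nat \<Rightarrow> real) set) \<Rightarrow> (nat \<Rightarrow> (nat \<Rightarrow> real) set) \<Rightarrow>
     ((nat \<Rightarrow> real) \<Rightarrow> nat \<Rightarrow> real) \<Rightarrow> bool"
  where "is_v n r P Q f \<longleftrightarrow> f \<in> Bij (cube n) \<and>
    (\<forall>i<r. f ` P i = Q i \<and>
      (\<forall>d\<in>{1..n}. \<exists>a b. a > 0 \<and> (\<forall>x\<in>P i. f x d = a * x d + b)))"

definition thompson_group :: "nat \<Rightarrow> ((nat \<Rightarrow> real) \<Rightarrow> nat \<Rightarrow> real) monoid"
  where "thompson_group n = (BijGroup (cube n))
    \<lparr>carrier := {f. \<exists>r P Q. numbered_pattern n r P \<and> numbered_pattern n r Q \<and> is_v n r P Q f}\<rparr>"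

end

theory Submission
  imports Defs "HOL-Algebra.Coset"
begin

text \<open>The generator of a vertex \<open>x\<close> is sent to a piecewise affine bijection that only changes the
  coordinates in \<open>D x\<close>, so that adjacent vertices give commuting maps. Choose pairwise distinct
  dyadic intervals \<open>J\<close> of equal length, one for each letter \<open>x\<close> or \<open>x\<^sup>-\<^sup>1\<close>, and one more
  containing \<open>0\<close>, and let \<open>P\<close> of a letter be the set of points all of whose coordinates in \<open>D x\<close>
  lie in its interval \<open>J\<close>. The map of \<open>x\<close> is chosen to send the complement of \<open>P x\<^sup>-\<^sup>1\<close> into \<open>P x\<close>.
  The sets of non-adjacent vertices are disjoint because they disagree in a common coordinate, so a
  reduced word moves the point \<open>0\<close> into the set of its first letter (ping-pong).\<close>


section \<open>Homomorphisms out of presented groups\<close>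

text \<open>The set of a letter constrains every coordinate in \<open>D x\<close>, because a
  non-adjacent vertex is only known to share some coordinate with \<open>x\<close>, and the
  intervals have to clash there whichever one it is. The sets of adjacent vertices do meet, which is
  the obstacle to plain ping-pong. What replaces disjointness is that a map leaves alone all
  coordinates on which the set of an adjacent letter depends, so it cannot affect membership in that
  set. A point of the orbit may thus lie in several sets at once, and the induction has to account
  for every letter that can be commuted to the front of the word. Maps that squeeze a large region
  into a small one exist because elements of \<open>nV\<close> need not preserve volume: a rectangle
  can be cut into any positive number of rectangles, so regions of different size can be given
  equally many pieces.\<close>

definition letter_value :: "('b, 'c) monoid_scheme \<Rightarrow> ('a \<Rightarrow> 'b) \<Rightarrow> 'a \<times> bool \<Rightarrow> 'b"
  where "letter_value G g l = (if snd l then g (fst l) else inv\<^bsub>G\<^esub> g (fst l))"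

definition word_value :: "('b, 'c) monoid_scheme \<Rightarrow> ('a \<Rightarrow> 'b) \<Rightarrow> 'a word \<Rightarrow> 'b"
  where "word_value G g w = foldr (\<lambda>l y. letter_value G g l \<otimes>\<^bsub>G\<^esub> y) w \<one>\<^bsub>G\<^esub>"

lemma word_value_Nil [simp]: "word_value G g [] = \<one>\<^bsub>G\<^esub>"
  and word_value_Cons [simp]:
    "word_value G g (l # w) = letter_value G g l \<otimes>\<^bsub>G\<^esub> word_value G g w"
  by (simp_all add: word_value_def)

lemma words_Nil [simp]: "[] \<in> words S"
  and words_Cons [simp]: "l # w \<in> words S \<longleftrightarrow> fst l \<in> S \<and> w \<in> words S"
  and words_append [simp]: "u @ w \<in> words S \<longleftrightarrow> u \<in> words S \<and> w \<in> words S"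
  by (auto simp: words_def mem_Times_iff)

context group
begin

lemma letter_value_closed:
  assumes "g \<in> S \<rightarrow> carrier G" "fst l \<in> S"
  shows "letter_value G g l \<in> carrier G"
  using assms by (auto simp: letter_value_def)

lemma word_value_closed:
  assumes "g \<in> S \<rightarrow> carrier G" "w \<in> words S"
  shows "word_value G g w \<in> carrier G"
  using assms(2) by (induction w) (auto simp: letter_value_closed[OF assms(1)])

lemma word_value_append:
  assumes "g \<in> S \<rightarrow> carrier G" "u \<in> words S" "w \<in> words S"
  shows "word_value G g (u @ w) = word_value G g u \<otimes> word_value G g w"
  using assms(2)
  by (induction u)
     (auto simp: assms(3) m_assoc letter_value_closed[OF assms(1)] word_value_closed[OF assms(1)])

text \<open>Von Dyck's argument, by induction on the derivation: every rule of the congruence is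
  sound in a group in which the relations hold.\<close>

lemma word_value_word_eq:
  assumes g: "g \<in> S \<rightarrow> carrier G"
    and R: "\<And>u w. (u, w) \<in> R \<Longrightarrow> u \<in> words S \<Longrightarrow> w \<in> words S \<Longrightarrow>
      word_value G g u = word_value G g w"
    and "word_eq S R u w"
  shows "word_value G g u = word_value G g w"
  using assms(3)
proof induction
  case (append u u' w w')
  then show ?case
    by (metis word_eq_words word_value_append[OF g])
next
  case (cancel x b)
  then have "g x \<in> carrier G" using g by auto
  then show ?case by (simp add: letter_value_def)
next
  case (sym u w)
  show ?case by (rule sym.IH[symmetric])
next
  case (trans t u w)
  show ?case by (rule HOL.trans[OF trans.IH])
next
  case (relation u w)
  then show ?case by (rule R)
qed simp

text \<open>Injectivity is tested on the kernel, which is all that \<open>faithful\<close> speaks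
  about. The image is recorded so that it can be located inside a smaller set of bijections
  afterwards.\<close>

theorem presented_group_embedding:
  assumes g: "g \<in> S \<rightarrow> carrier G"
    and R: "\<And>u w. (u, w) \<in> R \<Longrightarrow> u \<in> words S \<Longrightarrow> w \<in> words S \<Longrightarrow>
      word_value G g u = word_value G g w"
    and faithful: "\<And>w. w \<in> words S \<Longrightarrow> word_value G g w = \<one> \<Longrightarrow> word_eq S R w []"
  obtains h where "h \<in> hom (presented_group S R) G"
    "inj_on h (carrier (presented_group S R))"
    "h ` carrier (presented_group S R) = word_value G g ` words S"
proof -
  let ?P = "presented_group S R" and ?c = "\<lambda>w. word_rel S R `` {w}"
  \<comment> \<open>The value is constant on each equivalence class, so its image of a class is a
    singleton.\<close>
  define h where "h C = the_elem (word_value G g ` C)" for C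
  have h: "h (?c w) = word_value G g w" if "w \<in> words S" for w
  proof -
    have "word_value G g ` ?c w = {word_value G g w}"
    proof (intro subset_antisym subsetI)
      fix y assume "y \<in> word_value G g ` ?c w"
      then obtain u where "word_eq S R w u" "y = word_value G g u"
        by (auto simp: word_rel_def)
      then show "y \<in> {word_value G g w}"
        using word_value_word_eq[OF g R \<open>word_eq S R w u\<close>] by simp
    next
      fix y assume "y \<in> {word_value G g w}"
      then show "y \<in> word_value G g ` ?c w"
        using word_eq.refl[OF that, of R] by (simp add: word_rel_def)
    qed
    then show ?thesis by (simp add: h_def)
  qed
  have car: "carrier ?P = ?c ` words S"
    by (auto simp: presented_group_def quotient_def)
  have hom: "h \<in> hom ?P G"
    by (rule homI)
       (auto simp: car h presented_group_mult word_value_append[OF g] word_value_closed[OF g])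
  have "C = \<one>\<^bsub>?P\<^esub>" if C: "C \<in> carrier ?P" "h C = \<one>" for C
  proof -
    obtain w where w: "w \<in> words S" "C = ?c w" using C(1) unfolding car by blast
    then have "word_eq S R w []" using faithful C(2) h by auto
    then have "?c w = ?c []"
      by (intro equiv_class_eq[OF equiv_word_rel]) (simp add: word_rel_def)
    then show ?thesis using w by (simp add: presented_group_def)
  qed
  then have inj: "inj_on h (carrier ?P)"
    using inj_on_one_iff'[OF hom group_presented_group is_group] by blast
  have "h ` carrier ?P = word_value G g ` words S"
    by (auto simp: car h image_image)
  then show thesis using that hom inj by blast
qed

end


section \<open>Reduced words in right-angled Artin groups\<close>

text \<open>A name for the relations inside \<open>raag\<close>. They relate positive letters only;
  commutation with inverses has to be derived.\<close>

definition commutations :: "'v set set \<Rightarrow> ('v word \<times> 'v word) set"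
  where "commutations E = {([(u, True), (w, True)], [(w, True), (u, True)]) | u w. {u, w} \<in> E}"

text \<open>Excluded are the pairs of inverse letters that can be brought together by commuting one
  of them across \<open>u\<close>. No order is imposed on commuting letters, so this is not a normal
  form: an element can have several reduced words.\<close>

definition reduced :: "'v set set \<Rightarrow> 'v word \<Rightarrow> bool"
  where "reduced E w \<longleftrightarrow> (\<nexists>t x b u v.
    w = t @ (x, b) # u @ (x, \<not> b) # v \<and> (\<forall>l\<in>set u. {fst l, x} \<in> E))"

lemma word_eq_context:
  assumes "word_eq S R u w" "t \<in> words S" "v \<in> words S"
  shows "word_eq S R (t @ u @ v) (t @ w @ v)"
  using assms by (intro word_eq.append word_eq.refl)

text \<open>Insert the trivial pair \<open>[(x, b), (x, \<not> b)]\<close> on the right, commute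
  \<open>l\<close> with \<open>(x, b)\<close>, and cancel on the left. Applied to each of the two
  letters in turn, this extends the commutations to all signs.\<close>

lemma word_eq_swap_inverse:
  assumes "word_eq S R [(x, b), l] [l, (x, b)]"
  shows "word_eq S R [(x, \<not> b), l] [l, (x, \<not> b)]"
proof -
  have S: "x \<in> S" "fst l \<in> S" using word_eq_words[OF assms] by auto
  have c: "word_eq S R [(x, \<not> b), (x, b)] []"
    using word_eq.cancel[OF S(1), of R "\<not> b"] by simp
  have "word_eq S R [(x, \<not> b), l] [(x, \<not> b), l, (x, b), (x, \<not> b)]"
    using word_eq_context[OF word_eq.sym[OF word_eq.cancel[OF S(1), of R b]],
        of "[(x, \<not> b), l]" "[]"] S
    by simp
  moreover have "word_eq S R [(x, \<not> b), l, (x, b), (x, \<not> b)] [(x, \<not> b), (x, b), l, (x, \<not> b)]"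
    using word_eq_context[OF word_eq.sym[OF assms], of "[(x, \<not> b)]" "[(x, \<not> b)]"] S by simp
  moreover have "word_eq S R [(x, \<not> b), (x, b), l, (x, \<not> b)] [l, (x, \<not> b)]"
    using word_eq_context[OF c, of "[]" "[l, (x, \<not> b)]"] S by simp
  ultimately show ?thesis by (meson word_eq.trans)
qed

lemma word_eq_swap_letters:
  assumes "{x, y} \<in> E" "x \<in> V" "y \<in> V"
  shows "word_eq V (commutations E) [(x, b), (y, c)] [(y, c), (x, b)]"
proof -
  have "word_eq V (commutations E) [(x, True), (y, True)] [(y, True), (x, True)]"
    using assms by (intro word_eq.relation) (auto simp: commutations_def)
  then have "word_eq V (commutations E) [(x, b), (y, True)] [(y, True), (x, b)]"
    using word_eq_swap_inverse[of V _ x True "(y, True)"] by (cases b) auto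
  then have "word_eq V (commutations E) [(y, True), (x, b)] [(x, b), (y, True)]"
    by (rule word_eq.sym)
  then have "word_eq V (commutations E) [(y, c), (x, b)] [(x, b), (y, c)]"
    using word_eq_swap_inverse[of V _ y True "(x, b)"] by (cases c) auto
  then show ?thesis by (rule word_eq.sym)
qed

lemma word_eq_move_letter:
  assumes "\<forall>l\<in>set u. {fst l, x} \<in> E" "x \<in> V" "u \<in> words V"
  shows "word_eq V (commutations E) ((x, b) # u) (u @ [(x, b)])"
  using assms(1,3)
proof (induction u)
  case Nil
  then show ?case using assms(2) by (auto intro: word_eq.refl)
next
  case (Cons l u)
  obtain y c where l: "l = (y, c)" by (cases l)
  have yx: "{x, y} \<in> E" "y \<in> V" "u \<in> words V" using Cons.prems l by (auto simp: insert_commute)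
  have "word_eq V (commutations E) ((x, b) # l # u) (l # (x, b) # u)"
    using word_eq_context[OF word_eq_swap_letters[OF yx(1) assms(2) yx(2)], of "[]" u b c] yx l
    by simp
  moreover have "word_eq V (commutations E) (l # (x, b) # u) (l # u @ [(x, b)])"
    using word_eq_context[OF Cons.IH, of "[l]" "[]"] Cons.prems by simp
  ultimately show ?case unfolding append_Cons by (rule word_eq.trans)
qed

text \<open>A violation of \<open>reduced\<close> allows a cancellation that removes two letters, so
  induction on the length terminates.\<close>

lemma word_eq_reduced:
  assumes "w \<in> words V"
  obtains r where "word_eq V (commutations E) w r" "reduced E r"
proof -
  have "\<exists>r. word_eq V (commutations E) w r \<and> reduced E r"
    using assms
  proof (induction w rule: length_induct)
    case (1 w)
    show ?case
    proof (cases "reduced E w")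
      case True
      then show ?thesis using 1 by (blast intro: word_eq.refl)
    next
      case False
      then obtain t x b u v where w: "w = t @ (x, b) # u @ (x, \<not> b) # v"
        and u: "\<forall>l\<in>set u. {fst l, x} \<in> E" by (auto simp: reduced_def)
      have S: "t \<in> words V" "x \<in> V" "u \<in> words V" "v \<in> words V" using 1(2) w by auto
      have "word_eq V (commutations E) w (t @ u @ (x, b) # (x, \<not> b) # v)"
        using word_eq_context[OF word_eq_move_letter[OF u S(2,3)], of t "(x, \<not> b) # v"] S w
        by simp
      moreover have "word_eq V (commutations E) (t @ u @ (x, b) # (x, \<not> b) # v) (t @ u @ v)"
        using word_eq_context[OF word_eq.cancel[OF S(2)], of "t @ u" v] S by simp
      moreover have "\<exists>r. word_eq V (commutations E) (t @ u @ v) r \<and> reduced E r"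
        using 1 S w by simp
      ultimately show ?thesis by (meson word_eq.trans)
    qed
  qed
  then show thesis using that by blast
qed

lemma reduced_Cons:
  assumes "reduced E (l # w)"
  shows "reduced E w"
  unfolding reduced_def
proof
  assume "\<exists>t x b u v. w = t @ (x, b) # u @ (x, \<not> b) # v \<and> (\<forall>l\<in>set u. {fst l, x} \<in> E)"
  then obtain t x b u v where "l # w = (l # t) @ (x, b) # u @ (x, \<not> b) # v"
    "\<forall>l\<in>set u. {fst l, x} \<in> E" by auto
  then show False using assms unfolding reduced_def by blast
qed

text \<open>The second conclusion is what makes the induction work: the orbit point of a reduced word
  lies in the attracting set of a letter only if that letter can be shuffled to the front.\<close>

lemma reduced_ping_pong:
  fixes act :: "'v \<times> bool \<Rightarrow> 'x \<Rightarrow> 'x" and P :: "'v \<times> bool \<Rightarrow> 'x set"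
  assumes maps: "\<And>l z. fst l \<in> V \<Longrightarrow> z \<in> X \<Longrightarrow> act l z \<in> X"
    and attract: "\<And>x b z. x \<in> V \<Longrightarrow> z \<in> X \<Longrightarrow> z \<notin> P (x, \<not> b) \<Longrightarrow> act (x, b) z \<in> P (x, b)"
    and disj: "\<And>k l. fst k \<in> V \<Longrightarrow> fst l \<in> V \<Longrightarrow> k \<noteq> l \<Longrightarrow> {fst k, fst l} \<notin> E \<Longrightarrow> P k \<inter> P l = {}"
    and comm: "\<And>k l z. {fst k, fst l} \<in> E \<Longrightarrow> fst k \<in> V \<Longrightarrow> fst l \<in> V \<Longrightarrow> z \<in> X \<Longrightarrow>
      act k z \<in> P l \<Longrightarrow> z \<in> P l"
    and loopfree: "\<And>x. {x} \<notin> E"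
    and base: "z \<in> X" "\<And>l. fst l \<in> V \<Longrightarrow> z \<notin> P l"
    and "w \<in> words V" "reduced E w"
  shows "w \<noteq> [] \<Longrightarrow> foldr act w z \<in> P (hd w)"
    and "fst l \<in> V \<Longrightarrow> foldr act w z \<in> P l \<Longrightarrow>
      \<exists>u v. w = u @ l # v \<and> (\<forall>k\<in>set u. {fst k, fst l} \<in> E)"
proof -
  have "foldr act w z \<in> X \<and> (w \<noteq> [] \<longrightarrow> foldr act w z \<in> P (hd w)) \<and>
    (\<forall>l. fst l \<in> V \<longrightarrow> foldr act w z \<in> P l \<longrightarrow>
      (\<exists>u v. w = u @ l # v \<and> (\<forall>k\<in>set u. {fst k, fst l} \<in> E)))"
    using assms(8,9)
  proof (induction w)
    case Nil
    then show ?case using base by simp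
  next
    case (Cons k w)
    obtain x b where k: "k = (x, b)" by (cases k)
    have x: "x \<in> V" "w \<in> words V" using Cons.prems k by auto
    have red: "reduced E w" using Cons.prems reduced_Cons by blast
    let ?z = "foldr act w z"
    have z: "?z \<in> X" using Cons.IH x red by blast
    \<comment> \<open>Otherwise the inverse letter could be shuffled to the front of the tail
      \<open>w\<close>, where it would cancel with \<open>k\<close>, against reducedness.\<close>
    have "?z \<notin> P (x, \<not> b)"
    proof
      assume "?z \<in> P (x, \<not> b)"
      then obtain u v where "w = u @ (x, \<not> b) # v" "\<forall>l\<in>set u. {fst l, x} \<in> E"
        using Cons.IH x red by (metis fst_conv)
      then have "k # w = [] @ (x, b) # u @ (x, \<not> b) # v \<and> (\<forall>l\<in>set u. {fst l, x} \<in> E)"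
        using k by simp
      then show False using Cons.prems(2) unfolding reduced_def by blast
    qed
    then have Pk: "act k ?z \<in> P k" using attract x z k by blast
    have "\<exists>u v. k # w = u @ l # v \<and> (\<forall>k\<in>set u. {fst k, fst l} \<in> E)"
      if l: "fst l \<in> V" "act k ?z \<in> P l" for l
    proof (cases "k = l")
      case True
      then show ?thesis by (metis append_Nil empty_iff empty_set)
    next
      case False
      \<comment> \<open>Two distinct letters whose sets share a point must commute. The point was
        then in \<open>P l\<close> before \<open>k\<close> acted, so \<open>l\<close> can be moved
        to the front of the tail and past \<open>k\<close> as well.\<close>
      then have kl: "{fst k, fst l} \<in> E" using disj[of k l] l Pk x k by auto
      then have "?z \<in> P l" using comm l z x k by (metis fst_conv)
      then obtain u v where "w = u @ l # v" "\<forall>k\<in>set u. {fst k, fst l} \<in> E"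
        using Cons.IH x red l by blast
      then have "k # w = (k # u) @ l # v \<and> (\<forall>k\<in>set (k # u). {fst k, fst l} \<in> E)"
        using kl by simp
      then show ?thesis by blast
    qed
    then show ?case using Pk maps z x k by auto
  qed
  then show "w \<noteq> [] \<Longrightarrow> foldr act w z \<in> P (hd w)"
    and "fst l \<in> V \<Longrightarrow> foldr act w z \<in> P l \<Longrightarrow>
      \<exists>u v. w = u @ l # v \<and> (\<forall>k\<in>set u. {fst k, fst l} \<in> E)"
    by blast+
qed


section \<open>Dyadic intervals\<close>

definition dyadic :: "nat \<Rightarrow> nat \<Rightarrow> real set"
  where "dyadic k a = {real a / 2 ^ k ..< (real a + 1) / 2 ^ k}"

lemma dyadic_interval_iff: "dyadic_interval J \<longleftrightarrow> (\<exists>k a. a < 2 ^ k \<and> J = dyadic k a)"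
  by (simp add: dyadic_interval_def dyadic_def)

lemma dyadic_interval_dyadic: "a < 2 ^ k \<Longrightarrow> dyadic_interval (dyadic k a)"
  by (auto simp: dyadic_interval_iff)

text \<open>Membership becomes an equation between integers, which reduces disjointness, covering
  and nesting to facts about floors.\<close>

lemma mem_dyadic_iff: "x \<in> dyadic k a \<longleftrightarrow> \<lfloor>x * 2 ^ k\<rfloor> = int a"
  by (simp add: dyadic_def floor_eq_iff field_simps)

lemma left_end_in_dyadic: "real a / 2 ^ k \<in> dyadic k a"
  by (simp add: mem_dyadic_iff)

lemma dyadic_nonempty: "dyadic k a \<noteq> {}"
  using left_end_in_dyadic by blast

lemma dyadic_disjoint: "a \<noteq> b \<Longrightarrow> dyadic k a \<inter> dyadic k b = {}"
  by (auto simp: mem_dyadic_iff)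

lemma dyadic_halves: "dyadic k a = dyadic (Suc k) (2 * a) \<union> dyadic (Suc k) (2 * a + 1)"
  by (auto simp: dyadic_def field_simps)

lemma dyadic_subset_unit: "a < 2 ^ k \<Longrightarrow> dyadic k a \<subseteq> {0..<1}"
proof -
  assume "a < 2 ^ k"
  then have "a + 1 \<le> 2 ^ k" by simp
  then have "real (a + 1) \<le> real (2 ^ k)" by (rule of_nat_mono)
  then have "(real a + 1) / 2 ^ k \<le> 1" by simp
  then show ?thesis
    by (auto simp: dyadic_def intro: order_less_le_trans order_trans[rotated])
qed

lemma unit_covered_by_dyadic:
  assumes "x \<in> {0..<1}"
  obtains a where "a < 2 ^ k" "x \<in> dyadic k a"
proof
  have "0 \<le> x * 2 ^ k" "x * 2 ^ k < 2 ^ k" using assms by auto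
  then show "x \<in> dyadic k (nat \<lfloor>x * 2 ^ k\<rfloor>)" "nat \<lfloor>x * 2 ^ k\<rfloor> < 2 ^ k"
    by (auto simp: mem_dyadic_iff floor_less_iff nat_less_iff)
qed

text \<open>The ancestor at level \<open>k\<close> is found by integer division, because the floor
  of a quotient by a positive integer is the integer quotient of the floor.\<close>

lemma dyadic_nested:
  assumes "k \<le> l"
  shows "dyadic l b \<subseteq> dyadic k (b div 2 ^ (l - k))"
proof
  fix x assume "x \<in> dyadic l b"
  then have x: "\<lfloor>x * 2 ^ l\<rfloor> = int b" by (simp add: mem_dyadic_iff)
  have "x * 2 ^ k = (x * 2 ^ l) / real_of_int (2 ^ (l - k))"
    using assms by (simp add: field_simps flip: power_add)
  then have "\<lfloor>x * 2 ^ k\<rfloor> = int b div 2 ^ (l - k)"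
    using x by (simp only: floor_divide_real_eq_div zero_le_power zero_le_numeral)
  then show "x \<in> dyadic k (b div 2 ^ (l - k))"
    by (simp add: mem_dyadic_iff zdiv_int)
qed

lemma dyadic_interval_nonempty: "dyadic_interval J \<Longrightarrow> J \<noteq> {}"
  using dyadic_nonempty by (auto simp: dyadic_interval_iff)

lemma dyadic_interval_subset_unit: "dyadic_interval J \<Longrightarrow> J \<subseteq> {0..<1}"
  using dyadic_subset_unit by (auto simp: dyadic_interval_iff)

lemma dyadic_interval_unit: "dyadic_interval {0..<1}"
  unfolding dyadic_interval_iff by (rule exI[of _ 0], rule exI[of _ 0]) (simp add: dyadic_def)

text \<open>Dyadic intervals are nested or disjoint, so a nonempty intersection is one of the two
  intervals.\<close>

lemma dyadic_interval_Int:
  assumes "dyadic_interval J" "dyadic_interval K" "J \<inter> K \<noteq> {}"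
  shows "dyadic_interval (J \<inter> K)"
proof -
  have *: "dyadic l b \<subseteq> dyadic k a" if "k \<le> l" "dyadic k a \<inter> dyadic l b \<noteq> {}" for k a l b
    using dyadic_nested[OF that(1), of b] dyadic_disjoint[of a "b div 2 ^ (l - k)" k] that(2)
    by blast
  obtain k a l b where J: "J = dyadic k a" and K: "K = dyadic l b"
    using assms by (auto simp: dyadic_interval_iff)
  have "J \<subseteq> K \<or> K \<subseteq> J"
    using *[of k l a b] *[of l k b a] assms(3) J K by (metis inf_commute nle_le)
  then show ?thesis using assms by (metis inf.absorb1 inf.absorb2)
qed

lemma image_affine_atLeastLessThan:
  fixes p q s t :: real
  assumes "p > 0"
  shows "(\<lambda>x. p * x + q) ` {s..<t} = {p * s + q..<p * t + q}"
proof (intro subset_antisym subsetI)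
  fix y assume "y \<in> {p * s + q..<p * t + q}"
  then have "(y - q) / p \<in> {s..<t}" "y = p * ((y - q) / p) + q"
    using assms by (auto simp: field_simps)
  then show "y \<in> (\<lambda>x. p * x + q) ` {s..<t}" by blast
qed (use assms in auto)

text \<open>Comparing endpoints, an increasing affine map from an interval of level \<open>k\<close>
  onto one of level \<open>k'\<close> has slope \<open>2 ^ k / 2 ^ k'\<close>. It therefore sends
  the \<open>r\<close>-th of the \<open>2 ^ (l - k)\<close> equal parts of \<open>J\<close> to the
  \<open>r\<close>-th of as many equal parts of the image.\<close>

lemma dyadic_interval_affine_image:
  fixes p q :: real
  assumes p: "p > 0"
    and J: "dyadic_interval J" "dyadic_interval ((\<lambda>x. p * x + q) ` J)"
    and K: "dyadic_interval K" "K \<subseteq> J"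
  shows "dyadic_interval ((\<lambda>x. p * x + q) ` K)"
proof -
  obtain k a where a: "J = dyadic k a" using J by (auto simp: dyadic_interval_iff)
  obtain k' a' where a': "a' < 2 ^ k'" "(\<lambda>x. p * x + q) ` J = dyadic k' a'"
    using J by (auto simp: dyadic_interval_iff)
  obtain l b where b: "K = dyadic l b" using K by (auto simp: dyadic_interval_iff)
  have "{p * (a / 2 ^ k) + q..<p * ((real a + 1) / 2 ^ k) + q} = {real a' / 2 ^ k'..<(real a' + 1) / 2 ^ k'}"
    using a'(2) unfolding a dyadic_def image_affine_atLeastLessThan[OF p] .
  moreover have "p * (a / 2 ^ k) + q < p * ((real a + 1) / 2 ^ k) + q"
    using p by (simp add: divide_strict_right_mono)
  moreover have "real a' / 2 ^ k' < (real a' + 1) / 2 ^ k'"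
    by (simp add: divide_strict_right_mono)
  ultimately have ends: "p * (a / 2 ^ k) + q = a' / 2 ^ k'"
    "p * ((real a + 1) / 2 ^ k) + q = (real a' + 1) / 2 ^ k'"
    using atLeastLessThan_inj by blast+
  then have "p / 2 ^ k = 1 / 2 ^ k'" by (simp add: field_simps)
  then have pk: "p = 2 ^ k / 2 ^ k'" by (simp add: field_simps)
  have "k \<le> l"
  proof (rule ccontr)
    assume "\<not> k \<le> l"
    have "{real b / 2 ^ l..<(real b + 1) / 2 ^ l} \<subseteq> {real a / 2 ^ k..<(real a + 1) / 2 ^ k}"
      using K(2) unfolding a b dyadic_def .
    moreover have "real b / 2 ^ l < (real b + 1) / 2 ^ l" by (simp add: divide_strict_right_mono)
    ultimately have "a / 2 ^ k \<le> real b / 2 ^ l" "(real b + 1) / 2 ^ l \<le> (real a + 1) / 2 ^ k"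
      by (auto simp: atLeastLessThan_subset_iff)
    then have "1 / 2 ^ l \<le> (1 / 2 ^ k :: real)" by (simp add: add_divide_distrib)
    then have "(2::real) ^ k \<le> 2 ^ l" by (simp add: field_simps)
    then show False using \<open>\<not> k \<le> l\<close> by simp
  qed
  have "K \<inter> dyadic k (b div 2 ^ (l - k)) \<noteq> {}"
    using dyadic_nested[OF \<open>k \<le> l\<close>, of b] dyadic_nonempty b by blast
  then have "a = b div 2 ^ (l - k)"
    using dyadic_disjoint[of a "b div 2 ^ (l - k)" k] K(2) a by blast
  define r where "r = b mod 2 ^ (l - k)"
  have br: "b = a * 2 ^ (l - k) + r" "r < 2 ^ (l - k)"
    unfolding \<open>a = b div 2 ^ (l - k)\<close> r_def by (simp_all only: div_mult_mod_eq) simp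
  \<comment> \<open>The index of the part of the image with the same relative position
    \<open>r\<close>.\<close>
  define c where "c = a' * 2 ^ (l - k) + r"
  have q: "q = a' / 2 ^ k' - a / 2 ^ k'" using ends(1) pk by (simp add: field_simps)
  \<comment> \<open>The cases \<open>s = 0\<close> and \<open>s = 1\<close> give the two endpoints
    of the image of \<open>K\<close>.\<close>
  have map_end: "p * ((b + s) / 2 ^ l) + q = (c + s) / 2 ^ (k' + (l - k))" for s :: real
  proof -
    have l: "(2::real) ^ l = 2 ^ k * 2 ^ (l - k)" using \<open>k \<le> l\<close> by (simp flip: power_add)
    show ?thesis
      unfolding pk q c_def br(1) l power_add by (simp add: field_simps)
  qed
  have "(\<lambda>x. p * x + q) ` K = dyadic (k' + (l - k)) c"
    unfolding b dyadic_def image_affine_atLeastLessThan[OF p]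
    using map_end[of 0] map_end[of 1] by (simp add: add.commute)
  moreover have "c < 2 ^ (k' + (l - k))"
  proof -
    have "c < (a' + 1) * 2 ^ (l - k)" using br(2) by (simp add: c_def)
    also have "\<dots> \<le> 2 ^ k' * 2 ^ (l - k)" using a'(1) by (intro mult_right_mono) auto
    finally show ?thesis by (simp add: power_add)
  qed
  ultimately show ?thesis by (auto simp: dyadic_interval_iff)
qed

lemma dyadic_interval_affine_map:
  assumes "dyadic_interval J" "dyadic_interval K"
  obtains p q :: real where "p > 0" "(\<lambda>x. p * x + q) ` J = K"
proof -
  obtain k a l b where J: "J = dyadic k a" and K: "K = dyadic l b"
    using assms by (auto simp: dyadic_interval_iff)
  define p q :: real where "p = 2 ^ k / 2 ^ l" and "q = (real b - real a) / 2 ^ l"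
  have "p > 0" by (simp add: p_def)
  moreover have "p * (real a / 2 ^ k) + q = b / 2 ^ l"
    "p * ((real a + 1) / 2 ^ k) + q = (real b + 1) / 2 ^ l"
    by (simp_all add: p_def q_def field_simps)
  then have "(\<lambda>x. p * x + q) ` J = K"
    unfolding J K dyadic_def image_affine_atLeastLessThan[OF \<open>p > 0\<close>] by simp
  ultimately show thesis by (rule that)
qed


section \<open>Piecewise affine bijections of boxes\<close>

text \<open>Cube, rectangle and pattern are repeated over an arbitrary index set, because each
  generator is first built on the coordinates in \<open>D x\<close> alone.\<close>

definition unit_box :: "'i set \<Rightarrow> ('i \<Rightarrow> real) set"
  where "unit_box I = (I \<rightarrow>\<^sub>E {0..<1})"

definition box :: "'i set \<Rightarrow> ('i \<Rightarrow> real) set \<Rightarrow> bool"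
  where "box I A \<longleftrightarrow> (\<exists>J. (\<forall>d\<in>I. dyadic_interval (J d)) \<and> A = Pi\<^sub>E I J)"

definition box_pattern :: "'i set \<Rightarrow> ('i \<Rightarrow> real) set set \<Rightarrow> bool"
  where "box_pattern I X \<longleftrightarrow>
    finite X \<and> (\<forall>A\<in>X. box I A) \<and> disjoint X \<and> \<Union>X = unit_box I"

text \<open>That the image is a box is a condition of its own: \<open>p\<close> and \<open>q\<close>
  are arbitrary reals, and such a map need not send a dyadic box to a dyadic box.\<close>

definition maps_box :: "'i set \<Rightarrow> (('i \<Rightarrow> real) \<Rightarrow> 'i \<Rightarrow> real) \<Rightarrow> ('i \<Rightarrow> real) set \<Rightarrow> bool"
  where "maps_box I f A \<longleftrightarrow> box I A \<and> box I (f ` A) \<and>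
    (\<forall>d\<in>I. \<exists>p q. p > 0 \<and> (\<forall>x\<in>A. f x d = p * x d + q))"

text \<open>Numberings and the target pattern are left implicit: as \<open>f\<close> is a bijection
  of the cube, the images of the pieces form a pattern, and any numbering of the source is carried
  over to them.\<close>

definition thompson :: "'i set \<Rightarrow> (('i \<Rightarrow> real) \<Rightarrow> 'i \<Rightarrow> real) set"
  where "thompson I = {f \<in> Bij (unit_box I). \<exists>X. box_pattern I X \<and> (\<forall>A\<in>X. maps_box I f A)}"

lemma box_nonempty: "box I A \<Longrightarrow> A \<noteq> {}"
  by (auto simp: box_def PiE_eq_empty_iff dest!: dyadic_interval_nonempty)

lemma box_Int:
  assumes "box I A" "box I B" "A \<inter> B \<noteq> {}"
  shows "box I (A \<inter> B)"
proof -
  obtain J K where J: "\<forall>d\<in>I. dyadic_interval (J d)" "A = Pi\<^sub>E I J"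
    and K: "\<forall>d\<in>I. dyadic_interval (K d)" "B = Pi\<^sub>E I K"
    using assms by (auto simp: box_def)
  have "A \<inter> B = Pi\<^sub>E I (\<lambda>d. J d \<inter> K d)" by (simp add: J K PiE_Int)
  moreover from this have "\<forall>d\<in>I. J d \<inter> K d \<noteq> {}" using assms(3) by (simp add: PiE_eq_empty_iff)
  ultimately show ?thesis
    unfolding box_def using J K
    by (intro exI[of _ "\<lambda>d. J d \<inter> K d"]) (simp add: dyadic_interval_Int)
qed

lemma image_PiE_coordinatewise:
  assumes "\<And>x. x \<in> Pi\<^sub>E I K \<Longrightarrow> f x \<in> extensional I"
    and f: "\<And>x d. x \<in> Pi\<^sub>E I K \<Longrightarrow> d \<in> I \<Longrightarrow> f x d = \<phi> d (x d)"
  shows "f ` Pi\<^sub>E I K = Pi\<^sub>E I (\<lambda>d. \<phi> d ` K d)"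
proof (intro subset_antisym subsetI)
  fix y assume "y \<in> f ` Pi\<^sub>E I K"
  then show "y \<in> Pi\<^sub>E I (\<lambda>d. \<phi> d ` K d)"
    using assms by (auto simp: PiE_iff)
next
  fix y assume y: "y \<in> Pi\<^sub>E I (\<lambda>d. \<phi> d ` K d)"
  then have "\<forall>d\<in>I. \<exists>t. t \<in> K d \<and> y d = \<phi> d t" by (auto simp: PiE_iff)
  then obtain t where t: "\<And>d. d \<in> I \<Longrightarrow> t d \<in> K d \<and> y d = \<phi> d (t d)" by metis
  have x: "restrict t I \<in> Pi\<^sub>E I K" using t by auto
  have "f (restrict t I) = y"
    by (rule extensionalityI[of _ I]) (use assms(1)[OF x] y f[OF x] t in \<open>auto simp: PiE_iff\<close>)
  then show "y \<in> f ` Pi\<^sub>E I K" using x by blast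
qed

text \<open>This is what permits refining a pattern. The image of \<open>A\<close> is both a product
  of coordinate images and a product of dyadic intervals; a nonempty product determines its factors,
  so each coordinate map takes a dyadic interval onto a dyadic interval and
  \<open>dyadic_interval_affine_image\<close> applies to its parts.\<close>

lemma maps_box_subset:
  assumes f: "maps_box I f A" and C: "box I C" "C \<subseteq> A"
  shows "maps_box I f C"
proof -
  obtain J where J: "\<forall>d\<in>I. dyadic_interval (J d)" "A = Pi\<^sub>E I J"
    using f by (auto simp: maps_box_def box_def)
  obtain L where L: "\<forall>d\<in>I. dyadic_interval (L d)" "f ` A = Pi\<^sub>E I L"
    using f unfolding maps_box_def box_def by blast
  obtain K where K: "\<forall>d\<in>I. dyadic_interval (K d)" "C = Pi\<^sub>E I K"
    using C by (auto simp: box_def)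
  have "\<forall>d\<in>I. \<exists>p q. p > 0 \<and> (\<forall>x\<in>A. f x d = p * x d + q)"
    using f by (simp add: maps_box_def)
  then obtain p q where p: "\<And>d. d \<in> I \<Longrightarrow> p d > 0"
    and pq: "\<And>d x. d \<in> I \<Longrightarrow> x \<in> A \<Longrightarrow> f x d = p d * x d + q d" by metis
  let ?\<phi> = "\<lambda>d t. p d * t + q d"
  have ext: "f x \<in> extensional I" if "x \<in> A" for x
    using that L(2) by (auto simp: PiE_iff)
  have "Pi\<^sub>E I (\<lambda>d. ?\<phi> d ` J d) = Pi\<^sub>E I L"
    using image_PiE_coordinatewise[of I J f ?\<phi>] ext pq J L by auto
  then have JL: "?\<phi> d ` J d = L d" if "d \<in> I" for d
    using that L dyadic_interval_nonempty by (auto simp: PiE_eq_iff)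
  have KJ: "K d \<subseteq> J d" if "d \<in> I" for d
    using that C(2) box_nonempty[OF C(1)] unfolding J K by (simp add: subset_PiE)
  have "f ` C = Pi\<^sub>E I (\<lambda>d. ?\<phi> d ` K d)"
    unfolding K by (rule image_PiE_coordinatewise) (use C ext pq K in auto)
  moreover have "dyadic_interval (?\<phi> d ` K d)" if "d \<in> I" for d
    using dyadic_interval_affine_image[OF p, of d "J d" "q d" "K d"] that J L K JL KJ by metis
  ultimately have "box I (f ` C)"
    unfolding box_def by (intro exI[of _ "\<lambda>d. ?\<phi> d ` K d"]) simp
  then show ?thesis using f C unfolding maps_box_def by blast
qed

lemma maps_box_inverse:
  assumes f: "maps_box I f A" and g: "\<And>x. x \<in> A \<Longrightarrow> g (f x) = x"
  shows "maps_box I g (f ` A)"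
proof -
  have "g ` f ` A = A" using g by force
  moreover have "\<exists>p q. p > 0 \<and> (\<forall>y\<in>f ` A. g y d = p * y d + q)" if "d \<in> I" for d
  proof -
    obtain p q where "p > 0" "\<forall>x\<in>A. f x d = p * x d + q"
      using f \<open>d \<in> I\<close> unfolding maps_box_def by blast
    then have "1 / p > 0 \<and> (\<forall>y\<in>f ` A. g y d = 1 / p * y d + (- q / p))"
      using g by (auto simp: field_simps)
    then show ?thesis by blast
  qed
  ultimately show ?thesis using f by (simp add: maps_box_def)
qed

lemma maps_box_compose:
  assumes g: "maps_box I g A" and f: "maps_box I f (g ` A)"
    and h: "\<And>x. x \<in> A \<Longrightarrow> h x = f (g x)"
  shows "maps_box I h A"
proof -
  have "h ` A = f ` g ` A" using h by force
  moreover have "\<exists>p q. p > 0 \<and> (\<forall>x\<in>A. h x d = p * x d + q)" if "d \<in> I" for d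
  proof -
    obtain p q where "p > 0" "\<forall>x\<in>A. g x d = p * x d + q"
      using g \<open>d \<in> I\<close> unfolding maps_box_def by blast
    moreover obtain p' q' where "p' > 0" "\<forall>y\<in>g ` A. f y d = p' * y d + q'"
      using f \<open>d \<in> I\<close> unfolding maps_box_def by blast
    ultimately have "p' * p > 0 \<and> (\<forall>x\<in>A. h x d = (p' * p) * x d + (p' * q + q'))"
      using h by (auto simp: algebra_simps)
    then show ?thesis by blast
  qed
  ultimately show ?thesis using f g by (simp add: maps_box_def)
qed

section \<open>Closure of the piecewise affine bijections under the group operations\<close>

lemma Bij_bij_betw: "f \<in> Bij S \<Longrightarrow> bij_betw f S S"
  by (simp add: Bij_def)

text \<open>Recovers the target pattern that \<open>thompson\<close> leaves implicit. Distinct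
  pieces have distinct images, so a numbering of \<open>X\<close> also numbers the images.\<close>

lemma box_pattern_image:
  assumes f: "f \<in> Bij (unit_box I)" and X: "box_pattern I X" "\<And>A. A \<in> X \<Longrightarrow> box I (f ` A)"
  shows "box_pattern I ((`) f ` X)" and "inj_on ((`) f) X"
proof -
  let ?U = "unit_box I"
  have inj: "inj_on f ?U" and im: "f ` ?U = ?U"
    using Bij_bij_betw[OF f] by (auto simp: bij_betw_def)
  have sub: "A \<subseteq> ?U" if "A \<in> X" for A
    using X(1) that by (auto simp: box_pattern_def)
  show "inj_on ((`) f) X"
    using inj_on_image_eq_iff[OF inj] sub by (auto intro!: inj_onI)
  have "disjoint ((`) f ` X)"
  proof (rule disjointI)
    fix a b assume "a \<in> (`) f ` X" "b \<in> (`) f ` X" "a \<noteq> b"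
    then obtain A B where AB: "a = f ` A" "b = f ` B" "A \<in> X" "B \<in> X" "A \<noteq> B" by blast
    then have "A \<inter> B = {}" using X(1) by (auto simp: box_pattern_def disjoint_def)
    then show "a \<inter> b = {}"
      using inj_on_image_Int[OF inj sub[OF AB(3)] sub[OF AB(4)]] AB by simp
  qed
  moreover have "\<Union>((`) f ` X) = f ` \<Union>X" by blast
  ultimately show "box_pattern I ((`) f ` X)"
    using X im by (auto simp: box_pattern_def)
qed

lemma thompson_inverse:
  assumes "f \<in> thompson I"
  shows "(\<lambda>x\<in>unit_box I. inv_into (unit_box I) f x) \<in> thompson I"
proof -
  let ?U = "unit_box I" and ?g = "\<lambda>x\<in>unit_box I. inv_into (unit_box I) f x"
  obtain X where f: "f \<in> Bij ?U" and X: "box_pattern I X" "\<And>A. A \<in> X \<Longrightarrow> maps_box I f A"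
    using assms by (auto simp: thompson_def)
  have bij: "inj_on f ?U" "f ` ?U = ?U" using Bij_bij_betw[OF f] by (auto simp: bij_betw_def)
  have "maps_box I ?g B" if B: "B \<in> (`) f ` X" for B
  proof -
    obtain A where A: "A \<in> X" "B = f ` A" using B by blast
    then have "A \<subseteq> ?U" using X(1) by (auto simp: box_pattern_def)
    then have "?g (f x) = x" if "x \<in> A" for x
      using that bij by (auto simp: inv_into_f_f)
    then show ?thesis using maps_box_inverse X(2) A by blast
  qed
  moreover have "box_pattern I ((`) f ` X)"
    using box_pattern_image[OF f X(1)] X(2) by (auto simp: maps_box_def)
  moreover have "?g \<in> Bij ?U" using f by (rule restrict_inv_into_Bij)
  ultimately show ?thesis unfolding thompson_def by blast
qed

text \<open>The refined pattern consists of the nonempty sets of points of some \<open>A\<close> in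
  \<open>Y\<close> that \<open>g\<close> sends into some \<open>B\<close> in \<open>X\<close>. That
  such a set is a box is seen on the target side: its image under \<open>g\<close> is an
  intersection of two boxes, which the inverse of \<open>g\<close>, affine on the image of
  \<open>A\<close>, pulls back to a box.\<close>

lemma thompson_compose:
  assumes "f \<in> thompson I" "g \<in> thompson I"
  shows "compose (unit_box I) f g \<in> thompson I"
proof -
  let ?U = "unit_box I"
  obtain X where f: "f \<in> Bij ?U" and X: "box_pattern I X" "\<And>A. A \<in> X \<Longrightarrow> maps_box I f A"
    using assms(1) by (auto simp: thompson_def)
  obtain Y where g: "g \<in> Bij ?U" and Y: "box_pattern I Y" "\<And>A. A \<in> Y \<Longrightarrow> maps_box I g A"
    using assms(2) by (auto simp: thompson_def)
  have bij: "inj_on g ?U" "g ` ?U = ?U" using Bij_bij_betw[OF g] by (auto simp: bij_betw_def)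
  define Z where "Z = (\<lambda>(A, B). A \<inter> g -` B) ` (Y \<times> X) - {{}}"
  have maps: "maps_box I (compose ?U f g) C" if C: "C \<in> Z" for C
  proof -
    obtain A B where AB: "A \<in> Y" "B \<in> X" "C = A \<inter> g -` B" and "C \<noteq> {}"
      using C by (auto simp: Z_def)
    have A: "A \<subseteq> ?U" using AB Y(1) by (auto simp: box_pattern_def)
    have gC: "g ` C = g ` A \<inter> B" using AB by auto
    have inv: "inv_into ?U g (g x) = x" if "x \<in> A" for x
      using that A bij by (simp add: inv_into_f_f subset_iff)
    have "box I (g ` A \<inter> B)"
      using Y(2)[OF AB(1)] X(2)[OF AB(2)] gC \<open>C \<noteq> {}\<close>
      by (intro box_Int) (auto simp: maps_box_def)
    then have "maps_box I (inv_into ?U g) (g ` C)"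
      using maps_box_subset[OF maps_box_inverse[OF Y(2)[OF AB(1)] inv]] gC by auto
    moreover have "inv_into ?U g ` g ` C = C" using inv AB by force
    ultimately have "box I C" "box I (g ` C)" by (auto simp: maps_box_def)
    then have "maps_box I g C" "maps_box I f (g ` C)"
      using maps_box_subset[OF Y(2)[OF AB(1)]] maps_box_subset[OF X(2)[OF AB(2)]] AB gC by auto
    moreover have "compose ?U f g x = f (g x)" if "x \<in> C" for x
      using that A AB by (auto simp: compose_eq)
    ultimately show ?thesis by (rule maps_box_compose)
  qed
  have "box_pattern I Z"
    unfolding box_pattern_def
  proof (intro conjI ballI)
    show "finite Z" using X Y by (simp add: Z_def box_pattern_def)
    show "box I C" if "C \<in> Z" for C using maps[OF that] by (simp add: maps_box_def)
    show "disjoint Z"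
    proof (rule disjointI)
      fix C D assume "C \<in> Z" "D \<in> Z" "C \<noteq> D"
      then obtain A B A' B' where AB: "A \<in> Y" "A' \<in> Y" "B \<in> X" "B' \<in> X"
        and CD: "C = A \<inter> g -` B" "D = A' \<inter> g -` B'" and "A \<noteq> A' \<or> B \<noteq> B'"
        unfolding Z_def by blast
      have "disjoint X" "disjoint Y" using X(1) Y(1) by (simp_all add: box_pattern_def)
      then have "A \<inter> A' = {} \<or> B \<inter> B' = {}"
        using \<open>A \<noteq> A' \<or> B \<noteq> B'\<close> AB by (metis disjointD)
      then show "C \<inter> D = {}" unfolding CD by blast
    qed
    show "\<Union>Z = ?U"
    proof (intro subset_antisym subsetI)
      fix x assume "x \<in> \<Union>Z"
      then show "x \<in> ?U" using Y(1) by (auto simp: Z_def box_pattern_def)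
    next
      fix x assume "x \<in> ?U"
      then have "x \<in> \<Union>Y" "g x \<in> \<Union>X" using X(1) Y(1) bij by (auto simp: box_pattern_def)
      then obtain A B where "A \<in> Y" "B \<in> X" "x \<in> A \<inter> g -` B" by blast
      then show "x \<in> \<Union>Z" unfolding Z_def by blast
    qed
  qed
  then show ?thesis unfolding thompson_def using maps compose_Bij[OF f g] by blast
qed

lemma thompson_id: "(\<lambda>x\<in>unit_box I. x) \<in> thompson I"
proof -
  let ?i = "\<lambda>x\<in>unit_box I. x"
  have U: "box I (unit_box I)"
    using dyadic_interval_unit by (auto simp: box_def unit_box_def)
  then have "box_pattern I {unit_box I}" by (simp add: box_pattern_def)
  moreover have "?i ` unit_box I = unit_box I" by simp
  moreover have "1 > (0::real) \<and> (\<forall>x\<in>unit_box I. ?i x d = 1 * x d + 0)" for d by simp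
  ultimately show ?thesis
    using U id_Bij[of "unit_box I"] unfolding thompson_def maps_box_def
    by (intro CollectI conjI exI[of _ "{unit_box I}"] ballI exI[of _ 1] exI[of _ 0]) auto
qed

text \<open>Number the source pattern arbitrarily and let each image inherit the number of its
  piece; \<open>f\<close> is then the map \<open>v(P, Q)\<close> for these numberings.\<close>

lemma thompson_subset_thompson_group: "thompson {1..n} \<subseteq> carrier (thompson_group n)"
proof
  let ?I = "{1..n}"
  have pat: "pattern n X \<longleftrightarrow> box_pattern ?I X" for X
    by (simp add: pattern_def box_pattern_def rectangle_def box_def cube_def unit_box_def)
  fix f assume "f \<in> thompson ?I"
  then obtain X where f: "f \<in> Bij (unit_box ?I)" and X: "box_pattern ?I X"
    and maps: "\<And>A. A \<in> X \<Longrightarrow> maps_box ?I f A"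
    by (auto simp: thompson_def)
  have "finite X" using X by (simp add: box_pattern_def)
  then obtain P where P: "bij_betw P {..<card X} X"
    using ex_bij_betw_nat_finite by (metis lessThan_atLeast0)
  let ?Q = "\<lambda>i. f ` P i"
  have Q: "box_pattern ?I ((`) f ` X)" "inj_on ((`) f) X"
    using box_pattern_image[OF f X] maps by (auto simp: maps_box_def)
  then have "bij_betw ((`) f) X ((`) f ` X)" by (simp add: bij_betw_def)
  then have "bij_betw ?Q {..<card X} ((`) f ` X)"
    using bij_betw_trans[OF P] by (simp add: comp_def)
  then have "numbered_pattern n (card X) P" "numbered_pattern n (card X) ?Q"
    using X Q P unfolding numbered_pattern_def pat by blast+
  moreover have "is_v n (card X) P ?Q f"
    unfolding is_v_def
  proof (intro conjI allI impI)
    show "f \<in> Bij (cube n)" using f by (simp add: cube_def unit_box_def)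
    fix i assume "i < card X"
    then have "P i \<in> X" using bij_betwE[OF P] by blast
    then show "\<forall>d\<in>{1..n}. \<exists>a b. a > 0 \<and> (\<forall>x\<in>P i. f x d = a * x d + b)"
      using maps unfolding maps_box_def by blast
  qed simp
  ultimately show "f \<in> carrier (thompson_group n)"
    unfolding thompson_group_def by auto
qed

section \<open>Building elements from patterns and subdivisions\<close>

lemma boxes_affine_map:
  assumes "box I A" "box I B"
  obtains \<phi> where "maps_box I \<phi> A" "\<phi> ` A = B" "inj_on \<phi> A"
proof -
  obtain J where J: "\<forall>d\<in>I. dyadic_interval (J d)" "A = Pi\<^sub>E I J"
    using assms by (auto simp: box_def)
  obtain K where K: "\<forall>d\<in>I. dyadic_interval (K d)" "B = Pi\<^sub>E I K"
    using assms by (auto simp: box_def)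
  have "\<forall>d\<in>I. \<exists>p q :: real. p > 0 \<and> (\<lambda>t. p * t + q) ` J d = K d"
    using J(1) K(1) dyadic_interval_affine_map by metis
  then obtain p q :: "'a \<Rightarrow> real"
    where pq: "\<And>d. d \<in> I \<Longrightarrow> p d > 0" "\<And>d. d \<in> I \<Longrightarrow> (\<lambda>t. p d * t + q d) ` J d = K d"
    by metis
  define \<phi> where "\<phi> x = (\<lambda>d\<in>I. p d * x d + q d)" for x
  have "\<phi> ` A = Pi\<^sub>E I (\<lambda>d. (\<lambda>t. p d * t + q d) ` J d)"
    unfolding J by (rule image_PiE_coordinatewise) (auto simp: \<phi>_def)
  also have "\<dots> = B" unfolding K by (rule PiE_cong) (use pq in auto)
  finally have im: "\<phi> ` A = B" .
  moreover have "maps_box I \<phi> A"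
    unfolding maps_box_def im
  proof (intro conjI ballI assms)
    fix d assume "d \<in> I"
    then have "p d > 0 \<and> (\<forall>x\<in>A. \<phi> x d = p d * x d + q d)" using pq by (simp add: \<phi>_def)
    then show "\<exists>p q. p > 0 \<and> (\<forall>x\<in>A. \<phi> x d = p * x d + q)" by blast
  qed
  moreover have "inj_on \<phi> A"
  proof (rule inj_onI)
    fix x y assume xy: "x \<in> A" "y \<in> A" "\<phi> x = \<phi> y"
    show "x = y"
    proof (rule extensionalityI[of _ I])
      show "x \<in> extensional I" "y \<in> extensional I" using xy J by (auto simp: PiE_iff)
      fix d assume "d \<in> I"
      then show "x d = y d"
        using fun_cong[OF xy(3), of d] pq(1)[of d] by (simp add: \<phi>_def)
    qed
  qed
  ultimately show thesis using that by blast
qed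

lemma maps_box_cong:
  assumes "maps_box I f A" "\<And>x. x \<in> A \<Longrightarrow> g x = f x"
  shows "maps_box I g A"
proof -
  have "g ` A = f ` A" using assms(2) by simp
  then show ?thesis using assms by (simp add: maps_box_def)
qed

text \<open>The map \<open>v(P, Q)\<close> with a bijection of patterns in place of two numberings.
  Gluing the affine maps of the pieces gives a bijection because distinct pieces go onto disjoint
  members of \<open>Y\<close> and these cover the cube.\<close>

lemma thompson_piecewise:
  assumes X: "box_pattern I X" and Y: "box_pattern I Y" and \<sigma>: "bij_betw \<sigma> X Y"
  obtains F where "F \<in> thompson I" "\<And>A. A \<in> X \<Longrightarrow> F ` A = \<sigma> A"
proof -
  let ?U = "unit_box I"
  have "\<exists>\<phi>. maps_box I \<phi> A \<and> \<phi> ` A = \<sigma> A \<and> inj_on \<phi> A" if "A \<in> X" for A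
    using boxes_affine_map[of I A "\<sigma> A"] X Y bij_betwE[OF \<sigma>] that
    by (metis box_pattern_def)
  then obtain \<phi> where \<phi>: "\<And>A. A \<in> X \<Longrightarrow> maps_box I (\<phi> A) A"
    "\<And>A. A \<in> X \<Longrightarrow> \<phi> A ` A = \<sigma> A" "\<And>A. A \<in> X \<Longrightarrow> inj_on (\<phi> A) A"
    by metis
  have UX: "\<Union>X = ?U" and UY: "\<Union>Y = ?U" and dX: "disjoint X" and dY: "disjoint Y"
    using X Y by (auto simp: box_pattern_def)
  define F where "F = (\<lambda>x\<in>?U. \<phi> (THE A. A \<in> X \<and> x \<in> A) x)"
  have F: "F x = \<phi> A x" if "A \<in> X" "x \<in> A" for A x
  proof -
    have "(THE A. A \<in> X \<and> x \<in> A) = A"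
      using that dX by (intro the_equality) (auto dest: disjointD)
    then show ?thesis using that UX by (auto simp: F_def)
  qed
  have im: "F ` A = \<sigma> A" if "A \<in> X" for A
    using F[OF that] \<phi>(2)[OF that] by simp
  have "inj_on F ?U"
  proof (rule inj_onI)
    fix x y assume "x \<in> ?U" "y \<in> ?U" and eq: "F x = F y"
    then obtain A B where AB: "A \<in> X" "x \<in> A" "B \<in> X" "y \<in> B" using UX by blast
    then have "F x \<in> \<sigma> A \<inter> \<sigma> B" using im eq by blast
    moreover have "\<sigma> A \<in> Y" "\<sigma> B \<in> Y" using AB bij_betwE[OF \<sigma>] by auto
    ultimately have "\<sigma> A = \<sigma> B" using disjointD[OF dY, of "\<sigma> A" "\<sigma> B"] by blast
    then have "A = B" using AB \<sigma> by (meson bij_betw_imp_inj_on inj_onD)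
    then show "x = y" using \<phi>(3)[OF AB(1)] AB eq F by (auto dest: inj_onD)
  qed
  moreover have "F ` ?U = ?U"
  proof -
    have "F ` ?U = (\<Union>A\<in>X. F ` A)" using UX by blast
    also have "\<dots> = \<Union>(\<sigma> ` X)" using im by simp
    also have "\<dots> = ?U" using \<sigma> UY by (simp add: bij_betw_def)
    finally show ?thesis .
  qed
  ultimately have "F \<in> Bij ?U" by (simp add: Bij_def bij_betw_def F_def)
  moreover have "maps_box I F A" if "A \<in> X" for A
    using maps_box_cong[OF \<phi>(1)[OF that]] F[OF that] by blast
  ultimately have "F \<in> thompson I" using X by (auto simp: thompson_def)
  then show thesis using that im by blast
qed

text \<open>One coordinate \<open>e\<close> is halved and the others are kept. With no coordinates
  the only box is a single point, which cannot be split.\<close>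

lemma box_halves:
  assumes "box I A" "I \<noteq> {}"
  obtains B C where "box I B" "box I C" "B \<inter> C = {}" "B \<union> C = A"
proof -
  obtain J where J: "\<forall>d\<in>I. dyadic_interval (J d)" "A = Pi\<^sub>E I J"
    using assms by (auto simp: box_def)
  obtain e where e: "e \<in> I" using assms(2) by blast
  obtain k a where a: "a < 2 ^ k" "J e = dyadic k a"
    using J e by (auto simp: dyadic_interval_iff)
  let ?B = "Pi\<^sub>E I (J(e := dyadic (Suc k) (2 * a)))"
  let ?C = "Pi\<^sub>E I (J(e := dyadic (Suc k) (2 * a + 1)))"
  have upd: "box I (Pi\<^sub>E I (J(e := dyadic (Suc k) b)))" if "b < 2 ^ Suc k" for b
    unfolding box_def using J(1) that
    by (intro exI[of _ "J(e := dyadic (Suc k) b)"]) (auto intro: dyadic_interval_dyadic)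
  have "box I ?B" "box I ?C" using a(1) by (auto intro!: upd)
  moreover have "?B \<inter> ?C = {}"
    unfolding PiE_Int PiE_eq_empty_iff
    using dyadic_disjoint[of "2 * a" "2 * a + 1" "Suc k"] e by (intro bexI[of _ e]) auto
  moreover have "?B \<union> ?C = A"
  proof -
    have mem: "x \<in> Pi\<^sub>E I (J(e := L)) \<longleftrightarrow> x \<in> extensional I \<and> x e \<in> L \<and> (\<forall>d\<in>I - {e}. x d \<in> J d)"
      for x L using e by (auto simp: PiE_iff)
    have "x \<in> A \<longleftrightarrow> x \<in> extensional I \<and> x e \<in> dyadic k a \<and> (\<forall>d\<in>I - {e}. x d \<in> J d)" for x
      using mem[of x "J e"] by (simp only: fun_upd_triv J(2) flip: a(2))
    then show ?thesis unfolding set_eq_iff Un_iff mem dyadic_halves[of k a] by blast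
  qed
  ultimately show thesis by (rule that)
qed

text \<open>Halving one piece raises the count by exactly one, so every positive count is
  reached.\<close>

lemma box_split:
  assumes "box I A" "I \<noteq> {}"
  obtains S where "finite S" "card S = Suc r" "\<forall>B\<in>S. box I B" "disjoint S" "\<Union>S = A"
proof -
  have "\<exists>S. finite S \<and> card S = Suc r \<and> (\<forall>B\<in>S. box I B) \<and> disjoint S \<and> \<Union>S = A"
    using assms(1)
  proof (induction r arbitrary: A)
    case 0
    then show ?case by (intro exI[of _ "{A}"]) simp
  next
    case (Suc r)
    obtain B C where BC: "box I B" "box I C" "B \<inter> C = {}" "B \<union> C = A"
      using box_halves[OF Suc.prems assms(2)] .
    obtain S where S: "finite S" "card S = Suc r" "\<forall>B\<in>S. box I B" "disjoint S" "\<Union>S = C"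
      using Suc.IH[OF BC(2)] by blast
    have "B \<notin> S" using S(5) BC(3) box_nonempty[OF BC(1)] by blast
    moreover have "disjoint (insert B S)"
      using S(4,5) BC(3) by (auto simp: disjoint_def)
    ultimately show ?case using S BC by (intro exI[of _ "insert B S"]) auto
  qed
  then show thesis using that by blast
qed

lemma grid:
  fixes k :: nat
  assumes "finite I"
  defines "G \<equiv> (\<lambda>c. Pi\<^sub>E I (\<lambda>d. dyadic k (c d))) ` (I \<rightarrow>\<^sub>E {..<2 ^ k})"
  shows "box_pattern I G"
  unfolding box_pattern_def
proof (intro conjI ballI)
  show "finite G" unfolding G_def using assms(1) by (intro finite_imageI finite_PiE) auto
  show "box I A" if A: "A \<in> G" for A
  proof -
    obtain c where "c \<in> I \<rightarrow>\<^sub>E {..<2 ^ k}" "A = Pi\<^sub>E I (\<lambda>d. dyadic k (c d))"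
      using A by (auto simp: G_def)
    then show ?thesis
      unfolding box_def dyadic_interval_iff
      by (intro exI[of _ "\<lambda>d. dyadic k (c d)"]) (auto simp: PiE_iff)
  qed
  show "disjoint G"
  proof (rule disjointI)
    fix A B assume "A \<in> G" "B \<in> G" "A \<noteq> B"
    then obtain c c' where c: "A = Pi\<^sub>E I (\<lambda>d. dyadic k (c d))" "B = Pi\<^sub>E I (\<lambda>d. dyadic k (c' d))"
      by (auto simp: G_def)
    then obtain d where "d \<in> I" "c d \<noteq> c' d" using \<open>A \<noteq> B\<close> by (metis PiE_cong)
    then have "dyadic k (c d) \<inter> dyadic k (c' d) = {}" using dyadic_disjoint by blast
    then show "A \<inter> B = {}" using \<open>d \<in> I\<close> unfolding c PiE_Int PiE_eq_empty_iff by blast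
  qed
  show "\<Union>G = unit_box I"
  proof (intro subset_antisym subsetI)
    fix x assume "x \<in> \<Union>G"
    then obtain c where c: "c \<in> I \<rightarrow>\<^sub>E {..<2 ^ k}" "x \<in> Pi\<^sub>E I (\<lambda>d. dyadic k (c d))"
      by (auto simp: G_def)
    have "x d \<in> {0..<1}" if "d \<in> I" for d
      using that c dyadic_subset_unit[of "c d" k] by (auto simp: PiE_iff)
    then show "x \<in> unit_box I" using c by (auto simp: unit_box_def PiE_iff)
  next
    fix x assume x: "x \<in> unit_box I"
    then have "\<forall>d\<in>I. \<exists>a<2 ^ k. x d \<in> dyadic k a"
      using unit_covered_by_dyadic[of "x _" k] by (metis PiE_mem unit_box_def)
    then obtain c where c: "\<And>d. d \<in> I \<Longrightarrow> c d < 2 ^ k \<and> x d \<in> dyadic k (c d)" by metis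
    have "restrict c I \<in> I \<rightarrow>\<^sub>E {..<2 ^ k}" "x \<in> Pi\<^sub>E I (\<lambda>d. dyadic k (restrict c I d))"
      using c x by (auto simp: unit_box_def PiE_iff)
    then show "x \<in> \<Union>G" unfolding G_def by blast
  qed
qed

text \<open>The complement of a grid cube and the cube itself are cut into equally many boxes, and the
  map exchanges the roles of the two: complement to target cube, source cube to complement.\<close>

lemma thompson_attracting:
  assumes I: "finite I" "I \<noteq> {}" and pq: "p < 2 ^ k" "q < 2 ^ k" "p \<noteq> q"
  obtains F where "F \<in> thompson I"
    "\<And>x. x \<in> unit_box I \<Longrightarrow> x \<notin> (I \<rightarrow>\<^sub>E dyadic k p) \<Longrightarrow> F x \<in> (I \<rightarrow>\<^sub>E dyadic k q)"
proof -
  define G where "G = (\<lambda>c. Pi\<^sub>E I (\<lambda>d. dyadic k (c d))) ` (I \<rightarrow>\<^sub>E {..<2 ^ k})"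
  have G: "box_pattern I G" unfolding G_def using grid[OF I(1)] .
  define P Q where P_def: "P = (I \<rightarrow>\<^sub>E dyadic k p)" and Q_def: "Q = (I \<rightarrow>\<^sub>E dyadic k q)"
  have cell: "(I \<rightarrow>\<^sub>E dyadic k r) \<in> G" if "r < 2 ^ k" for r
    unfolding G_def using that by (intro image_eqI[of _ _ "\<lambda>d\<in>I. r"] PiE_cong) auto
  have PQ: "P \<in> G" "Q \<in> G" unfolding P_def Q_def using cell pq by auto
  have "P \<noteq> Q"
    unfolding P_def Q_def
    using dyadic_disjoint[OF pq(3), of k] dyadic_nonempty I(2) by (auto simp: PiE_eq_iff)
  \<comment> \<open>The pieces of \<open>P\<close> must be as many as the cells outside
    \<open>P\<close>; the shift by one matches the count \<open>Suc r\<close> in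
    \<open>box_split\<close>. Leaving out \<open>Q\<close> instead of \<open>P\<close> gives the
    same number.\<close>
  define N where "N = card (G - {P}) - 1"
  have fin: "finite G" using G by (simp add: box_pattern_def)
  moreover have "G - {P} \<noteq> {}" using PQ(2) \<open>P \<noteq> Q\<close> by blast
  ultimately have "card (G - {P}) \<noteq> 0" by simp
  then have card: "card (G - {P}) = Suc N" "card (G - {Q}) = Suc N"
    using fin PQ by (simp_all add: N_def)
  have subdivide: "\<exists>S. finite S \<and> card S = Suc N \<and> \<Union>S = B \<and> (G - {B}) \<inter> S = {} \<and>
      box_pattern I ((G - {B}) \<union> S)" if B: "B \<in> G" for B
  proof -
    have "box I B" using G B by (simp add: box_pattern_def)
    then obtain S where S: "finite S" "card S = Suc N" "\<forall>B\<in>S. box I B" "disjoint S" "\<Union>S = B"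
      using box_split[OF _ I(2)] by metis
    have dG: "disjoint G" using G by (simp add: box_pattern_def)
    have apart: "A \<inter> C = {}" if "A \<in> G - {B}" "C \<in> S" for A C
    proof -
      have "A \<inter> B = {}" using disjointD[OF dG] that B by blast
      then show ?thesis using that S(5) by blast
    qed
    \<comment> \<open>A common member would be disjoint from itself, whereas boxes are
      nonempty.\<close>
    have "(G - {B}) \<inter> S = {}"
    proof (rule equals0I)
      fix C assume "C \<in> (G - {B}) \<inter> S"
      then have "C \<inter> C = {}" "box I C" using apart[of C C] S(3) by blast+
      then show False using box_nonempty[of I C] by simp
    qed
    moreover have "disjoint ((G - {B}) \<union> S)"
    proof (rule disjointI)
      fix A C assume "A \<in> (G - {B}) \<union> S" "C \<in> (G - {B}) \<union> S" "A \<noteq> C"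
      then show "A \<inter> C = {}"
        using apart disjointD[OF dG, of A C] disjointD[OF S(4), of A C] by blast
    qed
    moreover have "\<Union>((G - {B}) \<union> S) = \<Union>G" using S(5) B by blast
    ultimately show ?thesis
      using S G by (intro exI[of _ S]) (auto simp: box_pattern_def)
  qed
  obtain S where S: "finite S" "card S = Suc N" "\<Union>S = P" "(G - {P}) \<inter> S = {}"
    "box_pattern I ((G - {P}) \<union> S)" using subdivide[OF PQ(1)] by blast
  obtain T where T: "finite T" "card T = Suc N" "\<Union>T = Q" "(G - {Q}) \<inter> T = {}"
    "box_pattern I ((G - {Q}) \<union> T)" using subdivide[OF PQ(2)] by blast
  obtain \<alpha> where \<alpha>: "bij_betw \<alpha> (G - {P}) T"
    using finite_same_card_bij[of "G - {P}" T] fin T card by auto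
  obtain \<beta> where \<beta>: "bij_betw \<beta> S (G - {Q})"
    using finite_same_card_bij[of S "G - {Q}"] fin S card by auto
  define \<sigma> where "\<sigma> A = (if A \<in> G - {P} then \<alpha> A else \<beta> A)" for A
  have "bij_betw \<sigma> (G - {P}) T"
    using \<alpha> by (rule bij_betw_cong[THEN iffD1, rotated]) (simp add: \<sigma>_def)
  moreover have "bij_betw \<sigma> S (G - {Q})"
    using \<beta> by (rule bij_betw_cong[THEN iffD1, rotated]) (use S(4) in \<open>auto simp: \<sigma>_def\<close>)
  moreover have "T \<inter> (G - {Q}) = {}" using T(4) by blast
  ultimately have "bij_betw \<sigma> ((G - {P}) \<union> S) ((G - {Q}) \<union> T)"
    using bij_betw_combine[of \<sigma> "G - {P}" T S "G - {Q}"] by (simp add: Un_commute)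
  then obtain F where F: "F \<in> thompson I" "\<And>A. A \<in> (G - {P}) \<union> S \<Longrightarrow> F ` A = \<sigma> A"
    using thompson_piecewise[OF S(5) T(5)] by blast
  have "F x \<in> Q" if x: "x \<in> unit_box I" "x \<notin> P" for x
  proof -
    obtain A where A: "A \<in> G" "x \<in> A" using G x(1) unfolding box_pattern_def by blast
    then have A': "A \<in> G - {P}" using x(2) by blast
    then have "F ` A = \<alpha> A" using F(2) by (simp add: \<sigma>_def)
    moreover have "\<alpha> A \<in> T" using \<alpha> A' by (rule bij_betw_apply)
    ultimately show ?thesis using T(3) A(2) by blast
  qed
  then show thesis using that F(1) unfolding P_def Q_def by blast
qed


section \<open>Extending maps by the identity in the remaining coordinates\<close>

definition merge :: "'i set \<Rightarrow> 'i set \<Rightarrow> ('i \<Rightarrow> real) \<Rightarrow> ('i \<Rightarrow> real) \<Rightarrow> 'i \<Rightarrow> real"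
  where "merge I D a y = (\<lambda>d\<in>I. if d \<in> D then a d else y d)"

text \<open>For \<open>D \<subseteq> I\<close>, identifying the cube over \<open>I\<close> with the
  product of the cubes over \<open>D\<close> and \<open>I - D\<close>, this is the product of
  \<open>F\<close> with the identity.\<close>

definition lift :: "'i set \<Rightarrow> 'i set \<Rightarrow> (('i \<Rightarrow> real) \<Rightarrow> 'i \<Rightarrow> real) \<Rightarrow> ('i \<Rightarrow> real) \<Rightarrow> 'i \<Rightarrow> real"
  where "lift I D F = (\<lambda>x\<in>unit_box I. merge I D (F (restrict x D)) x)"

definition cylinder :: "'i set \<Rightarrow> 'i set \<Rightarrow> ('i \<Rightarrow> real) set \<Rightarrow> ('i \<Rightarrow> real) set"
  where "cylinder I D A = {x \<in> unit_box I. restrict x D \<in> A}"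

lemma restrict_in_unit_box:
  assumes "x \<in> unit_box I" "D \<subseteq> I"
  shows "restrict x D \<in> unit_box D"
  using assms by (auto simp: unit_box_def PiE_iff)

lemma merge_in_unit_box:
  assumes "a \<in> unit_box D" "y \<in> unit_box I"
  shows "merge I D a y \<in> unit_box I"
  using assms by (auto simp: merge_def unit_box_def PiE_iff)

lemma restrict_merge:
  assumes "a \<in> extensional D" "D \<subseteq> I"
  shows "restrict (merge I D a y) D = a"
  using assms by (intro extensionalityI[of _ D]) (auto simp: merge_def)

lemma merge_restrict:
  assumes "y \<in> extensional I"
  shows "merge I D (restrict y D) y = y"
  using assms by (intro extensionalityI[of _ I]) (auto simp: merge_def)

lemma merge_merge: "merge I D a (merge I D b y) = merge I D a y"
  by (auto simp: merge_def)

lemma unit_box_extensional: "x \<in> unit_box I \<Longrightarrow> x \<in> extensional I"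
  by (auto simp: unit_box_def PiE_iff)

lemma lift_other_coordinate:
  assumes "x \<in> unit_box I" "d \<in> I" "d \<notin> D"
  shows "lift I D F x d = x d"
  using assms by (simp add: lift_def merge_def)

lemma restrict_lift:
  assumes "x \<in> unit_box I" "D \<subseteq> I" "F \<in> unit_box D \<rightarrow> unit_box D"
  shows "restrict (lift I D F x) D = F (restrict x D)"
proof -
  have "F (restrict x D) \<in> unit_box D"
    using restrict_in_unit_box[OF assms(1,2)] assms(3) by blast
  then show ?thesis
    using assms(1) restrict_merge[OF unit_box_extensional assms(2)] by (simp add: lift_def)
qed

lemma cylinder_unit_box: "D \<subseteq> I \<Longrightarrow> cylinder I D (unit_box D) = unit_box I"
  using restrict_in_unit_box by (auto simp: cylinder_def)

lemma box_cylinder: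
  assumes "box D A" "D \<subseteq> I"
  shows "box I (cylinder I D A)"
proof -
  obtain J where J: "\<forall>d\<in>D. dyadic_interval (J d)" "A = Pi\<^sub>E D J"
    using assms by (auto simp: box_def)
  let ?K = "\<lambda>d. if d \<in> D then J d else {0..<1}"
  have "cylinder I D A = Pi\<^sub>E I ?K"
  proof (intro subset_antisym subsetI)
    fix x assume "x \<in> cylinder I D A"
    then show "x \<in> Pi\<^sub>E I ?K"
      using assms(2) J by (auto simp: cylinder_def unit_box_def PiE_iff)
  next
    fix x assume x: "x \<in> Pi\<^sub>E I ?K"
    have "x d \<in> {0..<1}" if "d \<in> I" for d
      using PiE_mem[OF x that] J(1) dyadic_interval_subset_unit[of "J d"]
      by (auto split: if_splits)
    then have "x \<in> unit_box I" using x by (simp add: unit_box_def PiE_iff)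
    moreover have "x d \<in> J d" if "d \<in> D" for d
      using PiE_mem[OF x, of d] assms(2) that by auto
    then have "restrict x D \<in> A" by (simp add: J(2))
    ultimately show "x \<in> cylinder I D A" by (simp add: cylinder_def)
  qed
  moreover have "\<forall>d\<in>I. dyadic_interval (?K d)"
    using J(1) dyadic_interval_unit by auto
  ultimately show ?thesis unfolding box_def by (intro exI[of _ ?K]) simp
qed

lemma lift_image_cylinder:
  assumes F: "F \<in> unit_box D \<rightarrow> unit_box D" and "D \<subseteq> I" "A \<subseteq> unit_box D"
  shows "lift I D F ` cylinder I D A = cylinder I D (F ` A)"
proof (intro subset_antisym subsetI)
  fix y assume "y \<in> lift I D F ` cylinder I D A"
  then obtain x where x: "x \<in> unit_box I" "restrict x D \<in> A" "y = lift I D F x"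
    by (auto simp: cylinder_def)
  moreover have "F (restrict x D) \<in> unit_box D" using x F assms(3) by blast
  ultimately show "y \<in> cylinder I D (F ` A)"
    using restrict_lift[OF x(1) assms(2) F] merge_in_unit_box
    by (auto simp: cylinder_def lift_def)
next
  fix y assume "y \<in> cylinder I D (F ` A)"
  then obtain a where y: "y \<in> unit_box I" "restrict y D = F a" "a \<in> A"
    by (auto simp: cylinder_def)
  have a: "a \<in> unit_box D" using y assms(3) by blast
  \<comment> \<open>The preimage of \<open>y\<close> takes its coordinates in \<open>D\<close> from
    \<open>a\<close> and keeps the remaining ones of \<open>y\<close>.\<close>
  have m: "merge I D a y \<in> unit_box I" "restrict (merge I D a y) D = a"
    using merge_in_unit_box[OF a y(1)] restrict_merge[OF unit_box_extensional[OF a] assms(2)]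
    by auto
  then have "lift I D F (merge I D a y) = merge I D (restrict y D) y"
    by (simp add: lift_def merge_merge y(2))
  then have "lift I D F (merge I D a y) = y"
    using merge_restrict[OF unit_box_extensional[OF y(1)]] by simp
  moreover have "merge I D a y \<in> cylinder I D A" using m y by (simp add: cylinder_def)
  ultimately show "y \<in> lift I D F ` cylinder I D A" by force
qed

text \<open>The cylinders over a pattern of the smaller cube form a pattern of the larger one. Each
  has the full unit interval in the new coordinates, where the lifted map has slope 1 and offset
  0.\<close>

lemma lift_thompson:
  assumes "F \<in> thompson D" "D \<subseteq> I"
  shows "lift I D F \<in> thompson I"
proof -
  obtain X where F: "F \<in> Bij (unit_box D)" and X: "box_pattern D X" "\<And>A. A \<in> X \<Longrightarrow> maps_box D F A"
    using assms(1) by (auto simp: thompson_def)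
  have Fun: "F \<in> unit_box D \<rightarrow> unit_box D" using F by (rule Bij_imp_funcset)
  have sub: "A \<subseteq> unit_box D" if "A \<in> X" for A
    using X(1) that by (auto simp: box_pattern_def)
  have "inj_on (lift I D F) (unit_box I)"
  proof (rule inj_onI)
    fix x y assume xy: "x \<in> unit_box I" "y \<in> unit_box I" "lift I D F x = lift I D F y"
    then have "F (restrict x D) = F (restrict y D)"
      using restrict_lift[OF _ assms(2) Fun] by metis
    then have r: "restrict x D = restrict y D"
      using Bij_bij_betw[OF F] restrict_in_unit_box[OF _ assms(2)] xy
      by (meson bij_betw_imp_inj_on inj_onD)
    show "x = y"
    proof (rule extensionalityI[of _ I])
      fix d assume "d \<in> I"
      then show "x d = y d"
        using fun_cong[OF r, of d] fun_cong[OF xy(3), of d] lift_other_coordinate xy(1,2)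
        by (cases "d \<in> D") (auto simp: lift_other_coordinate)
    qed (use xy unit_box_extensional in auto)
  qed
  moreover have "lift I D F ` unit_box I = unit_box I"
    using lift_image_cylinder[OF Fun assms(2) order_refl] cylinder_unit_box[OF assms(2)]
      Bij_bij_betw[OF F] by (simp add: bij_betw_def)
  ultimately have "lift I D F \<in> Bij (unit_box I)"
    by (simp add: Bij_def bij_betw_def lift_def)
  moreover have "maps_box I (lift I D F) (cylinder I D A)" if A: "A \<in> X" for A
    unfolding maps_box_def lift_image_cylinder[OF Fun assms(2) sub[OF A]]
  proof (intro conjI ballI)
    show "box I (cylinder I D A)" "box I (cylinder I D (F ` A))"
      using X(2)[OF A] box_cylinder[OF _ assms(2)] by (simp_all add: maps_box_def)
    fix d assume "d \<in> I"
    show "\<exists>p q. p > 0 \<and> (\<forall>x\<in>cylinder I D A. lift I D F x d = p * x d + q)"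
    proof (cases "d \<in> D")
      case True
      then obtain p q where "p > 0" "\<forall>a\<in>A. F a d = p * a d + q"
        using X(2)[OF A] unfolding maps_box_def by blast
      then have "p > 0 \<and> (\<forall>x\<in>cylinder I D A. lift I D F x d = p * x d + q)"
        using True \<open>d \<in> I\<close> by (auto simp: cylinder_def lift_def merge_def)
      then show ?thesis by blast
    next
      case False
      then show ?thesis
        using \<open>d \<in> I\<close>
        by (intro exI[of _ 1] exI[of _ 0]) (auto simp: cylinder_def lift_other_coordinate)
    qed
  qed
  moreover have "box_pattern I (cylinder I D ` X)"
    unfolding box_pattern_def
  proof (intro conjI ballI)
    show "finite (cylinder I D ` X)" using X(1) by (simp add: box_pattern_def)
    show "box I C" if "C \<in> cylinder I D ` X" for C
      using that X(1) box_cylinder[OF _ assms(2)] by (auto simp: box_pattern_def)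
    show "disjoint (cylinder I D ` X)"
    proof (rule disjointI)
      fix C C' assume "C \<in> cylinder I D ` X" "C' \<in> cylinder I D ` X" "C \<noteq> C'"
      then obtain A B where AB: "A \<in> X" "B \<in> X" "C = cylinder I D A" "C' = cylinder I D B" "A \<noteq> B"
        by blast
      moreover have "disjoint X" using X(1) by (simp add: box_pattern_def)
      ultimately have "A \<inter> B = {}" by (auto dest: disjointD)
      then show "C \<inter> C' = {}" unfolding AB cylinder_def by blast
    qed
    have "\<Union>(cylinder I D ` X) = cylinder I D (\<Union>X)" by (auto simp: cylinder_def)
    then show "\<Union>(cylinder I D ` X) = unit_box I"
      using X(1) cylinder_unit_box[OF assms(2)] by (simp add: box_pattern_def)
  qed
  ultimately show ?thesis by (auto simp: thompson_def)
qed

lemma Bij_thompson: "f \<in> thompson I \<Longrightarrow> f \<in> Bij (unit_box I)"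
  by (simp add: thompson_def)

lemma lift_in_unit_box:
  assumes "F \<in> thompson D" "D \<subseteq> I" "x \<in> unit_box I"
  shows "lift I D F x \<in> unit_box I"
  using Bij_imp_funcset[OF Bij_thompson[OF lift_thompson[OF assms(1,2)]]] assms(3) by blast

text \<open>Neither map reads or changes the coordinates that the other one moves, so both
  composites act by \<open>F\<close> on \<open>D\<close>, by \<open>F'\<close> on \<open>D'\<close>,
  and trivially elsewhere.\<close>

lemma lift_commute:
  assumes "F \<in> thompson D" "F' \<in> thompson D'" "D \<subseteq> I" "D' \<subseteq> I" "D \<inter> D' = {}"
  shows "compose (unit_box I) (lift I D F) (lift I D' F') =
    compose (unit_box I) (lift I D' F') (lift I D F)"
proof (rule extensionalityI[of _ "unit_box I"])
  fix x assume x: "x \<in> unit_box I"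
  have y: "lift I D F x \<in> unit_box I" "lift I D' F' x \<in> unit_box I"
    using lift_in_unit_box x assms by blast+
  have r: "restrict (lift I D' F' x) D = restrict x D" "restrict (lift I D F x) D' = restrict x D'"
    using assms(3-5) by (intro restrict_ext lift_other_coordinate[OF x]; blast)+
  have "lift I D F (lift I D' F' x) = lift I D' F' (lift I D F x)"
  proof (rule extensionalityI[of _ I])
    fix d assume "d \<in> I"
    then show "lift I D F (lift I D' F' x) d = lift I D' F' (lift I D F x) d"
      using r x y assms(5) by (auto simp: lift_def merge_def)
  qed (use x y in \<open>auto simp: lift_def merge_def\<close>)
  then show "compose (unit_box I) (lift I D F) (lift I D' F') x =
      compose (unit_box I) (lift I D' F') (lift I D F) x"
    using x by (simp add: compose_eq)
qed auto


section \<open>The embedding\<close>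

lemma BijGroup_mult:
  assumes "f \<in> Bij S" "g \<in> Bij S"
  shows "f \<otimes>\<^bsub>BijGroup S\<^esub> g = compose S f g"
  using assms by (simp add: BijGroup_def)

text \<open>Turns the product in the group into the successive action of the letters, which is the
  form used by the ping-pong lemma.\<close>

lemma word_value_BijGroup:
  assumes "g \<in> V \<rightarrow> Bij S" "w \<in> words V" "z \<in> S"
  shows "word_value (BijGroup S) g w z = foldr (letter_value (BijGroup S) g) w z"
  using assms(2)
proof (induction w)
  case Nil
  then show ?case using assms(3) by (simp add: BijGroup_def)
next
  case (Cons l w)
  have g: "g \<in> V \<rightarrow> carrier (BijGroup S)" using assms(1) by (simp add: BijGroup_def)
  have "letter_value (BijGroup S) g l \<in> Bij S" "word_value (BijGroup S) g w \<in> Bij S"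
    using group.letter_value_closed[OF group_BijGroup g] group.word_value_closed[OF group_BijGroup g]
      Cons.prems by (auto simp: BijGroup_def)
  then show ?case using Cons assms(3) by (simp add: BijGroup_mult compose_eq)
qed

text \<open>The target is the full group of bijections, and the image is placed in
  \<open>thompson I\<close> letter by letter; the ping-pong argument itself only concerns bijections
  of the cube.\<close>

theorem raag_embedding:
  fixes D :: "'v \<Rightarrow> 'i set"
  assumes graph: "finite_simple_graph V E"
    and I: "finite I"
    and D: "\<And>x. x \<in> V \<Longrightarrow> D x \<noteq> {} \<and> D x \<subseteq> I"
    and edges: "\<And>x y. x \<in> V \<Longrightarrow> y \<in> V \<Longrightarrow> x \<noteq> y \<Longrightarrow> D x \<inter> D y = {} \<longleftrightarrow> {x, y} \<in> E"
  obtains h where "h \<in> hom (raag V E) (BijGroup (unit_box I))"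
    "inj_on h (carrier (raag V E))" "h ` carrier (raag V E) \<subseteq> thompson I"
proof -
  let ?U = "unit_box I" and ?G = "BijGroup (unit_box I)"
  have "finite V" and E: "\<And>e. e \<in> E \<Longrightarrow> \<exists>u\<in>V. \<exists>w\<in>V. u \<noteq> w \<and> e = {u, w}"
    using graph by (auto simp: finite_simple_graph_def)
  obtain m and index :: "'v \<Rightarrow> nat" where index: "index ` V = {i. i < m}" "inj_on index V"
    using finite_imp_inj_to_nat_seg[OF \<open>finite V\<close>] by blast
  \<comment> \<open>The vertex of index \<open>i\<close> gets the codes \<open>2 * i + 1\<close> and
    \<open>2 * i + 2\<close> for its two letters. Code 0 stays free: its interval contains the
    coordinates of the base point.\<close>
  define c where "c l = 2 * index (fst l) + (if snd l then 1 else 2)" for l :: "'v \<times> bool"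
  \<comment> \<open>The codes in use, together with 0, are \<open>0, ..., 2 * m\<close>. There are
    \<open>k\<close> of them, and level \<open>k\<close> provides \<open>2 ^ k > k\<close>
    intervals.\<close>
  define k where "k = 2 * m + 1"
  have c_bound: "c l < 2 ^ k" if "fst l \<in> V" for l
  proof -
    have "index (fst l) < m" using index(1) that by blast
    then have "c l < k" by (auto simp: c_def k_def)
    also have "k < 2 ^ k" by (rule less_exp)
    finally show ?thesis .
  qed
  have c_inj: "c l \<noteq> c l'" if "fst l \<in> V" "fst l' \<in> V" "l \<noteq> l'" for l l'
  proof
    assume "c l = c l'"
    then have "index (fst l) = index (fst l')" "snd l = snd l'"
      by (auto simp: c_def split: if_splits) presburger+
    then show False using that index(2) by (auto dest: inj_onD intro: prod_eqI)
  qed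
  have c_pos: "c l \<noteq> 0" for l by (simp add: c_def)

  have "\<exists>F. F \<in> thompson (D x) \<and> (\<forall>z\<in>unit_box (D x). z \<notin> (D x \<rightarrow>\<^sub>E dyadic k (c (x, False))) \<longrightarrow>
      F z \<in> (D x \<rightarrow>\<^sub>E dyadic k (c (x, True))))" if "x \<in> V" for x
  proof -
    have "finite (D x)" "D x \<noteq> {}" using D[OF that] I finite_subset by auto
    then show ?thesis
      using thompson_attracting[of "D x" "c (x, False)" k "c (x, True)"] c_bound c_inj that
      by (metis fst_conv prod.inject)
  qed
  then obtain F where F: "\<And>x. x \<in> V \<Longrightarrow> F x \<in> thompson (D x)"
    "\<And>x z. x \<in> V \<Longrightarrow> z \<in> unit_box (D x) \<Longrightarrow> z \<notin> (D x \<rightarrow>\<^sub>E dyadic k (c (x, False))) \<Longrightarrow>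
      F x z \<in> (D x \<rightarrow>\<^sub>E dyadic k (c (x, True)))" by metis

  define g where "g x = lift I (D x) (F x)" for x
  define P where "P l = {z \<in> ?U. \<forall>d\<in>D (fst l). z d \<in> dyadic k (c l)}" for l
  let ?act = "letter_value ?G g"
  have gT: "g x \<in> thompson I" if "x \<in> V" for x
    unfolding g_def by (rule lift_thompson[OF F(1)[OF that]]) (use D that in blast)
  then have gB: "g \<in> V \<rightarrow> Bij ?U" and gG: "g \<in> V \<rightarrow> carrier ?G"
    using Bij_thompson by (auto simp: BijGroup_def)
  have act_True: "?act (x, True) = g x" for x by (simp add: letter_value_def)
  have act_False: "?act (x, False) = (\<lambda>z\<in>?U. inv_into ?U (g x) z)" if "x \<in> V" for x
    using inv_BijGroup gB that by (auto simp: letter_value_def)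
  have actT: "?act l \<in> thompson I" if "fst l \<in> V" for l
  proof (cases l)
    case (Pair x b)
    then show ?thesis
      using act_True act_False thompson_inverse[OF gT] gT that by (cases b) auto
  qed
  have actU: "?act l z \<in> ?U" if "fst l \<in> V" "z \<in> ?U" for l z
    using Bij_imp_funcset[OF Bij_thompson[OF actT]] that by blast
  have g_inv: "g x (?act (x, False) z) = z" if "x \<in> V" "z \<in> ?U" for x z
    using Bij_bij_betw[OF Bij_thompson[OF gT[OF that(1)]]] that(2)
    by (simp add: act_False[OF that(1)] bij_betw_def f_inv_into_f)

  have g_other: "g x z d = z d" if "x \<in> V" "z \<in> ?U" "d \<in> I" "d \<notin> D x" for x z d
    unfolding g_def by (rule lift_other_coordinate[OF that(2-4)])
  have act_other: "?act l z d = z d" if "fst l \<in> V" "z \<in> ?U" "d \<in> I" "d \<notin> D (fst l)" for l z d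
  proof (cases l)
    case (Pair x b)
    \<comment> \<open>\<open>g x\<close> fixes coordinate \<open>d\<close> at the point
      \<open>?act (x, False) z\<close>, which it sends back to \<open>z\<close>.\<close>
    have "?act (x, False) z d = z d"
      using g_other[of x "?act (x, False) z" d] g_inv actU[of "(x, False)"] that Pair by simp
    then show ?thesis using Pair act_True g_other that by (cases b) auto
  qed
  have g_attract: "g x z \<in> P (x, True)" if "x \<in> V" "z \<in> ?U" "z \<notin> P (x, False)" for x z
  proof -
    have Dx: "D x \<subseteq> I" using D that(1) by blast
    have r: "restrict z (D x) \<in> unit_box (D x)" using restrict_in_unit_box[OF that(2) Dx] .
    have "restrict z (D x) \<notin> (D x \<rightarrow>\<^sub>E dyadic k (c (x, False)))"
      using that(2,3) by (auto simp: P_def PiE_iff)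
    then have F_in: "F x (restrict z (D x)) \<in> (D x \<rightarrow>\<^sub>E dyadic k (c (x, True)))"
      by (rule F(2)[OF that(1) r])
    have "restrict (g x z) (D x) = F x (restrict z (D x))"
      unfolding g_def
      by (rule restrict_lift[OF that(2) Dx Bij_imp_funcset[OF Bij_thompson[OF F(1)[OF that(1)]]]])
    then have "g x z d \<in> dyadic k (c (x, True))" if "d \<in> D x" for d
      using PiE_mem[OF F_in that] that by (metis restrict_apply')
    then show ?thesis using actU[of "(x, True)" z] that(1,2) by (simp add: P_def act_True)
  qed

  have attract: "?act (x, b) z \<in> P (x, b)" if "x \<in> V" "z \<in> ?U" "z \<notin> P (x, \<not> b)" for x b z
  proof (cases b)
    case True
    then show ?thesis using g_attract that act_True by simp
  next
    case False
    \<comment> \<open>The condition for the inverse is the contrapositive of that for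
      \<open>g x\<close>: from outside \<open>P (x, False)\<close>, \<open>g x\<close> would lead
      into \<open>P (x, True)\<close>, but it leads back to \<open>z\<close>, which lies
      outside.\<close>
    have "?act (x, False) z \<in> P (x, False)"
    proof (rule ccontr)
      assume "?act (x, False) z \<notin> P (x, False)"
      then have "g x (?act (x, False) z) \<in> P (x, True)"
        using g_attract that actU[of "(x, False)"] by simp
      then show False using g_inv that False by simp
    qed
    then show ?thesis using False by simp
  qed
  have adjacent: "x \<in> V \<and> y \<in> V \<and> D x \<inter> D y = {}" if xy: "{x, y} \<in> E" for x y
  proof -
    obtain u w where "u \<in> V" "w \<in> V" "u \<noteq> w" "{x, y} = {u, w}" using E[OF xy] by metis
    then have "x \<in> V" "y \<in> V" "x \<noteq> y" by (auto simp: doubleton_eq_iff)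
    then show ?thesis using edges[of x y] xy by simp
  qed
  have disj: "P l \<inter> P l' = {}"
    if l: "fst l \<in> V" "fst l' \<in> V" "l \<noteq> l'" "{fst l, fst l'} \<notin> E" for l l'
  proof -
    \<comment> \<open>For a letter and its own inverse any coordinate in \<open>D x\<close> is
      common; for distinct vertices a common one comes from non-adjacency.\<close>
    have "D (fst l) \<inter> D (fst l') \<noteq> {}"
      using edges l D by (cases "fst l = fst l'") auto
    then obtain d where "d \<in> D (fst l)" "d \<in> D (fst l')" by blast
    then show ?thesis
      using dyadic_disjoint[OF c_inj[OF l(1-3)], of k] by (auto simp: P_def)
  qed
  have comm: "z \<in> P l'"
    if l: "{fst l, fst l'} \<in> E" "fst l \<in> V" "fst l' \<in> V" "z \<in> ?U" "?act l z \<in> P l'" for l l' z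
  proof -
    have "z d \<in> dyadic k (c l')" if "d \<in> D (fst l')" for d
    proof -
      have "d \<in> I" "d \<notin> D (fst l)" using adjacent[OF l(1)] D[OF l(3)] that by auto
      then have "?act l z d = z d" by (rule act_other[OF l(2,4)])
      then show ?thesis using l(5) that by (auto simp: P_def)
    qed
    then show ?thesis using l(4) by (simp add: P_def)
  qed
  define origin where "origin = (\<lambda>d\<in>I. 0 :: real)"
  have origin: "origin \<in> ?U" by (auto simp: origin_def unit_box_def)
  have base: "origin \<notin> P l" if l: "fst l \<in> V" for l
  proof -
    obtain d where d: "d \<in> D (fst l)" "d \<in> I" using D[OF l] by blast
    have "0 \<in> dyadic k 0" using left_end_in_dyadic[of 0 k] by simp
    then have "origin d \<notin> dyadic k (c l)"
      using dyadic_disjoint[OF c_pos[of l], of k] d(2) by (auto simp: origin_def)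
    then show ?thesis using d(1) by (auto simp: P_def)
  qed
  have loopfree: "{x} \<notin> E" for x using E[of "{x}"] by auto

  interpret G: group ?G by (rule group_BijGroup)
  have R: "word_value ?G g u = word_value ?G g w"
    if uw: "(u, w) \<in> commutations E" for u w
  proof -
    obtain x y where xy: "{x, y} \<in> E" "u = [(x, True), (y, True)]" "w = [(y, True), (x, True)]"
      using uw by (auto simp: commutations_def)
    then have V: "x \<in> V" "y \<in> V" "D x \<inter> D y = {}" using adjacent by blast+
    have "compose ?U (g x) (g y) = compose ?U (g y) (g x)"
      unfolding g_def
      by (rule lift_commute[OF F(1)[OF V(1)] F(1)[OF V(2)] _ _ V(3)]) (use D V in blast)+
    then have "g x \<otimes>\<^bsub>?G\<^esub> g y = g y \<otimes>\<^bsub>?G\<^esub> g x"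
      using gB V by (simp add: BijGroup_mult Pi_iff)
    moreover have "g x \<in> carrier ?G" "g y \<in> carrier ?G" using gG V by auto
    ultimately show ?thesis using xy by (simp add: letter_value_def)
  qed
  have faithful: "word_eq V (commutations E) w []"
    if w: "w \<in> words V" "word_value ?G g w = \<one>\<^bsub>?G\<^esub>" for w
  proof -
    obtain r where r: "word_eq V (commutations E) w r" "reduced E r"
      using word_eq_reduced[OF w(1)] .
    have rV: "r \<in> words V" using word_eq_words[OF r(1)] by blast
    have "word_value ?G g r = \<one>\<^bsub>?G\<^esub>"
      using G.word_value_word_eq[OF gG R r(1)] w(2) by simp
    then have "foldr ?act r origin = origin"
      using word_value_BijGroup[OF gB rV origin] origin by (simp add: BijGroup_def)
    moreover have "foldr ?act r origin \<in> P (hd r)" if "r \<noteq> []"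
      by (rule reduced_ping_pong(1)[of V ?U ?act P E])
         (fact actU attract disj comm loopfree origin base rV r(2) that)+
    moreover have "fst (hd r) \<in> V" if "r \<noteq> []" using that rV by (cases r) auto
    ultimately have "r = []" using base by metis
    then show ?thesis using r(1) by simp
  qed
  obtain h where h: "h \<in> hom (presented_group V (commutations E)) ?G"
    "inj_on h (carrier (presented_group V (commutations E)))"
    "h ` carrier (presented_group V (commutations E)) = word_value ?G g ` words V"
    using G.presented_group_embedding[OF gG R faithful] by blast
  have wT: "word_value ?G g w \<in> thompson I" if "w \<in> words V" for w
    using that
  proof (induction w)
    case Nil
    then show ?case using thompson_id[of I] by (simp add: BijGroup_def restrict_def)
  next
    case (Cons l w)
    then have "?act l \<in> thompson I" "word_value ?G g w \<in> thompson I" using actT by auto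
    then show ?case by (simp add: BijGroup_mult Bij_thompson thompson_compose)
  qed
  have raag: "raag V E = presented_group V (commutations E)"
    by (simp add: raag_def commutations_def)
  show thesis
  proof (rule that)
    show "h \<in> hom (raag V E) ?G" "inj_on h (carrier (raag V E))" using h raag by simp_all
    show "h ` carrier (raag V E) \<subseteq> thompson I" unfolding raag h(3) using wT by blast
  qed
qed

theorem theorem3p1:
  fixes n m :: nat
    and V :: "'v set" and E :: "'v set set"
    and v :: "nat \<Rightarrow> 'v" and D :: "nat \<Rightarrow> nat set"
  assumes "n \<ge> 1"
    and "finite_simple_graph V E"
    and "bij_betw v {1..m} V"
    and "\<And>i. i \<in> {1..m} \<Longrightarrow> D i \<noteq> {} \<and> D i \<subseteq> {1..n}"
    and "\<And>i j. i \<in> {1..m} \<Longrightarrow> j \<in> {1..m} \<Longrightarrow> i \<noteq> j \<Longrightarrow>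
      D i \<inter> D j = {} \<longleftrightarrow> {v i, v j} \<in> E"
  shows "\<exists>h \<in> hom (raag V E) (thompson_group n). inj_on h (carrier (raag V E))"
proof -
  \<comment> \<open>Moves the coordinate sets from indices to the vertices themselves, where
    \<open>raag_embedding\<close> expects them.\<close>
  define w where "w = inv_into {1..m} v"
  have w: "w x \<in> {1..m}" "v (w x) = x" if "x \<in> V" for x
    using assms(3) that unfolding w_def bij_betw_def
    by (auto intro: inv_into_into f_inv_into_f simp del: atLeastAtMost_iff)
  have D: "D (w x) \<noteq> {} \<and> D (w x) \<subseteq> {1..n}" if "x \<in> V" for x
    using assms(4) w(1)[OF that] by blast
  have E: "D (w x) \<inter> D (w y) = {} \<longleftrightarrow> {x, y} \<in> E" if "x \<in> V" "y \<in> V" "x \<noteq> y" for x y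
    using assms(5)[of "w x" "w y"] w that by metis
  obtain h where h: "h \<in> hom (raag V E) (BijGroup (unit_box {1..n}))"
    "inj_on h (carrier (raag V E))" "h ` carrier (raag V E) \<subseteq> thompson {1..n}"
    using raag_embedding[OF assms(2) finite_atLeastAtMost D E] .
  \<comment> \<open>\<open>thompson_group n\<close> has the multiplication of the bijection group of
    the cube, so a homomorphism into the latter only has to be checked for its values.\<close>
  have "cube n = unit_box {1..n}" by (simp add: cube_def unit_box_def)
  then have "(\<otimes>\<^bsub>thompson_group n\<^esub>) = (\<otimes>\<^bsub>BijGroup (unit_box {1..n})\<^esub>)"
    by (simp add: thompson_group_def)
  moreover have "h C \<in> carrier (thompson_group n)" if "C \<in> carrier (raag V E)" for C
    using h(3) thompson_subset_thompson_group that by blast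
  ultimately have "h \<in> hom (raag V E) (thompson_group n)"
    using h(1) by (auto simp: hom_def)
  then show ?thesis using h(2) by blast
qed

end
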